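(* Let $d\ge 3$ and let $H\le\mathrm{Aut}(T_d)$ be non-discrete. (i) If $H$ is locally transitive, then $\mathrm{QZ}(H)$ contains no inversion. (ii) If $H$ is locally semiprimitive, then $\mathrm{QZ}(H)$ contains no non-trivial edge-fixating element. (iii) If $H$ is locally quasiprimitive, then $\mathrm{QZ}(H)$ contains no non-trivial elliptic element. (iv) If $H$ is locally $k$-transitive for some $k\in\mathbb{N}$, then $\mathrm{QZ}(H)$ contains no hyperbolic element of length $k$.
   Context: $T_d=(V,E)$ is the $d$-regular tree (Serre's convention: $E$ consists of oriented edges with inversion $e\mapsto\overline e$; $E(x)$ is the set of edges with origin $x$). $\mathrm{Aut}(T_d)$ carries the permutation topology for its action on $V\cup E$ (basic open sets prescribe the images of finitely many points). The quasi-center of a topological group $H$ is $\mathrm{QZ}(H):=\{h\in H\mid Z_H(h)\text{ is open in }H\}$. For $x\in V$, $H_x^{(1)}\le\mathrm{Sym}(E(x))$ is the permutation group induced by the stabilizer $H_x$ on $E(x)$. $H$ is locally "X" if $H_x^{(1)}$ has property "X" for all $x\in V$; with the exception that for $k\ge3$, $H$ is locally $k$-transitive if for every $x\in V$, $H_x$ acts transitively on the set of non-backtracking paths of length $k$ issuing from $x$. (Locally $1$-transitive means locally transitive.) A permutation group is quasiprimitive if it is transitive and all its non-trivial normal subgroups are transitive; semiprimitive if it is transitive and all its normal subgroups are transitive or semiregular (all point stabilizers trivial). Automorphism types: for $g\in\mathrm{Aut}(T_d)$ let $l(g)=\min_{x\in V}d(x,gx)$ and $V(g)=\{x\in V\mid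 d(x,gx)=l(g)\}$. If $l(g)=0$, $g$ is elliptic (it fixes a vertex). If $l(g)>0$ and $V(g)$ is infinite, $g$ is hyperbolic of length $l(g)$ (a translation of length $l(g)$ along a line). If $l(g)>0$ and $V(g)$ is finite then $l(g)=1$, $g$ maps some edge $e$ to $\overline e$ and $g$ is called an inversion. An element is edge-fixating if it fixes some edge $e\in E$. *)

theory Defs
  imports
    "HOL-Analysis.Analysis"
    "HOL-Algebra.Group_Action"
    "Graph_Theory.Bidirected_Digraph"
    "Graph_Theory.Arc_Walk"
    "Graph_Theory.Digraph_Component"
begin

section \<open>Regular trees in Serre's convention\<close>

text \<open>
  A graph in the sense of Serre is a \<^locale>\<open>bidirected_digraph\<close>: every arc is an oriented edge
  and \<open>arev\<close> is the fixed-point-free edge inversion. The edges with origin \<open>x\<close> are \<open>out_arcs T x\<close>.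
\<close>

definition nonbacktracking :: "('e \<Rightarrow> 'e) \<Rightarrow> 'e list \<Rightarrow> bool" where
  "nonbacktracking arev p \<longleftrightarrow> successively (\<lambda>e e'. e' \<noteq> arev e) p"

text \<open>
  The library's notion of a tree cannot be used here, since it forbids every directed cycle,
  including the walk along an edge followed by its inverse. Following Serre, a circuit is a
  nonempty closed path without backtracking whose termini are pairwise distinct.
\<close>
definition serre_tree :: "('v, 'e) pre_digraph \<Rightarrow> ('e \<Rightarrow> 'e) \<Rightarrow> bool" where
  "serre_tree T arev \<longleftrightarrow>
     bidirected_digraph T arev \<and> strongly_connected T \<and>
     \<not> (\<exists>p. pre_digraph.cycle T p \<and> nonbacktracking arev p)"

definition regular_tree :: "nat \<Rightarrow> ('v, 'e) pre_digraph \<Rightarrow> ('e \<Rightarrow> 'e) \<Rightarrow> bool" where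
  "regular_tree d T arev \<longleftrightarrow>
     serre_tree T arev \<and>
     (\<forall>x\<in>verts T. finite (out_arcs T x) \<and> card (out_arcs T x) = d)"


section \<open>The automorphism group and the permutation topology\<close>

text \<open>An automorphism is a pair consisting of its action on vertices and its action on edges.\<close>

definition tree_auts :: "('v, 'e) pre_digraph \<Rightarrow> ('e \<Rightarrow> 'e) \<Rightarrow> (('v \<Rightarrow> 'v) \<times> ('e \<Rightarrow> 'e)) set" where
  "tree_auts T arev =
     {g \<in> Bij (verts T) \<times> Bij (arcs T).
        \<forall>e\<in>arcs T. tail T (snd g e) = fst g (tail T e) \<and>
                    head T (snd g e) = fst g (head T e) \<and>
                    snd g (arev e) = arev (snd g e)}"

definition Aut :: "('v, 'e) pre_digraph \<Rightarrow> ('e \<Rightarrow> 'e) \<Rightarrow> (('v \<Rightarrow> 'v) \<times> ('e \<Rightarrow> 'e)) monoid" where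
  "Aut T arev = (BijGroup (verts T) \<times>\<times> BijGroup (arcs T))\<lparr>carrier := tree_auts T arev\<rparr>"

definition perm_topology ::
    "('v, 'e) pre_digraph \<Rightarrow> ('e \<Rightarrow> 'e) \<Rightarrow> (('v \<Rightarrow> 'v) \<times> ('e \<Rightarrow> 'e)) topology" where
  "perm_topology T arev = topology_generated_by
     {{h \<in> tree_auts T arev. (\<forall>x\<in>A. fst h x = fst g x) \<and> (\<forall>e\<in>B. snd h e = snd g e)} | g A B.
        g \<in> tree_auts T arev \<and> finite A \<and> A \<subseteq> verts T \<and> finite B \<and> B \<subseteq> arcs T}"

definition centralizer_of :: "('g, 'm) monoid_scheme \<Rightarrow> 'g \<Rightarrow> 'g set" where
  "centralizer_of G h = {g \<in> carrier G. g \<otimes>\<^bsub>G\<^esub> h = h \<otimes>\<^bsub>G\<^esub> g}"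

definition quasi_center :: "('g, 'm) monoid_scheme \<Rightarrow> 'g topology \<Rightarrow> 'g set" where
  "quasi_center G X = {h \<in> carrier G. openin X (centralizer_of G h)}"

definition QZ ::
    "('v, 'e) pre_digraph \<Rightarrow> ('e \<Rightarrow> 'e) \<Rightarrow> (('v \<Rightarrow> 'v) \<times> ('e \<Rightarrow> 'e)) set
      \<Rightarrow> (('v \<Rightarrow> 'v) \<times> ('e \<Rightarrow> 'e)) set" where
  "QZ T arev H =
     quasi_center ((Aut T arev)\<lparr>carrier := H\<rparr>) (subtopology (perm_topology T arev) H)"


section \<open>Permutation groups\<close>

text \<open>A permutation group on \<open>S\<close> is a subgroup of \<open>BijGroup S\<close>, acting by \<open>\<lambda>g. g\<close>.\<close>

definition perm_transitive :: "'a set \<Rightarrow> ('a \<Rightarrow> 'a) monoid \<Rightarrow> bool" where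
  "perm_transitive S P \<longleftrightarrow> transitive_action P S (\<lambda>g. g)"

definition perm_semiregular :: "'a set \<Rightarrow> ('a \<Rightarrow> 'a) monoid \<Rightarrow> bool" where
  "perm_semiregular S P \<longleftrightarrow> (\<forall>s\<in>S. stabilizer P (\<lambda>g. g) s = {\<one>\<^bsub>P\<^esub>})"

definition perm_quasiprimitive :: "'a set \<Rightarrow> ('a \<Rightarrow> 'a) monoid \<Rightarrow> bool" where
  "perm_quasiprimitive S P \<longleftrightarrow>
     perm_transitive S P \<and>
     (\<forall>N. N \<lhd> P \<and> N \<noteq> {\<one>\<^bsub>P\<^esub>} \<longrightarrow> perm_transitive S (P\<lparr>carrier := N\<rparr>))"

definition perm_semiprimitive :: "'a set \<Rightarrow> ('a \<Rightarrow> 'a) monoid \<Rightarrow> bool" where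
  "perm_semiprimitive S P \<longleftrightarrow>
     perm_transitive S P \<and>
     (\<forall>N. N \<lhd> P \<longrightarrow>
        perm_transitive S (P\<lparr>carrier := N\<rparr>) \<or> perm_semiregular S (P\<lparr>carrier := N\<rparr>))"

definition perm_k_transitive :: "nat \<Rightarrow> 'a set \<Rightarrow> ('a \<Rightarrow> 'a) monoid \<Rightarrow> bool" where
  "perm_k_transitive k S P \<longleftrightarrow>
     (\<forall>xs ys. set xs \<subseteq> S \<and> set ys \<subseteq> S \<and> distinct xs \<and> distinct ys \<and>
        length xs = k \<and> length ys = k \<longrightarrow> (\<exists>g\<in>carrier P. map g xs = ys))"


section \<open>Local actions\<close>

definition vertex_stabilizer ::
    "('v, 'e) pre_digraph \<Rightarrow> ('e \<Rightarrow> 'e) \<Rightarrow> (('v \<Rightarrow> 'v) \<times> ('e \<Rightarrow> 'e)) set \<Rightarrow> 'v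
      \<Rightarrow> (('v \<Rightarrow> 'v) \<times> ('e \<Rightarrow> 'e)) set" where
  "vertex_stabilizer T arev H x = stabilizer ((Aut T arev)\<lparr>carrier := H\<rparr>) fst x"

definition local_action ::
    "('v, 'e) pre_digraph \<Rightarrow> ('e \<Rightarrow> 'e) \<Rightarrow> (('v \<Rightarrow> 'v) \<times> ('e \<Rightarrow> 'e)) set \<Rightarrow> 'v
      \<Rightarrow> ('e \<Rightarrow> 'e) monoid" where
  "local_action T arev H x =
     (BijGroup (out_arcs T x))\<lparr>carrier :=
        (\<lambda>h. restrict (snd h) (out_arcs T x)) ` vertex_stabilizer T arev H x\<rparr>"

definition locally_sat ::
    "('v, 'e) pre_digraph \<Rightarrow> ('e \<Rightarrow> 'e) \<Rightarrow> (('v \<Rightarrow> 'v) \<times> ('e \<Rightarrow> 'e)) set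
      \<Rightarrow> ('e set \<Rightarrow> ('e \<Rightarrow> 'e) monoid \<Rightarrow> bool) \<Rightarrow> bool" where
  "locally_sat T arev H X \<longleftrightarrow> (\<forall>x\<in>verts T. X (out_arcs T x) (local_action T arev H x))"

definition nb_paths :: "('v, 'e) pre_digraph \<Rightarrow> ('e \<Rightarrow> 'e) \<Rightarrow> nat \<Rightarrow> 'v \<Rightarrow> 'e list set" where
  "nb_paths T arev k x =
     {p. (\<exists>y. pre_digraph.awalk T x p y) \<and> nonbacktracking arev p \<and> length p = k}"

text \<open>
  Only for \<open>k \<ge> 3\<close> does local \<open>k\<close>-transitivity refer to paths; for smaller \<open>k\<close> it is
  \<open>k\<close>-transitivity of the local permutation groups.
\<close>
definition locally_k_transitive ::
    "('v, 'e) pre_digraph \<Rightarrow> ('e \<Rightarrow> 'e) \<Rightarrow> (('v \<Rightarrow> 'v) \<times> ('e \<Rightarrow> 'e)) set \<Rightarrow> nat \<Rightarrow> bool" where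
  "locally_k_transitive T arev H k \<longleftrightarrow>
     (if k \<ge> 3 then
        (\<forall>x\<in>verts T. \<forall>p\<in>nb_paths T arev k x. \<forall>q\<in>nb_paths T arev k x.
           \<exists>h\<in>vertex_stabilizer T arev H x. map (snd h) p = q)
      else locally_sat T arev H (perm_k_transitive k))"


section \<open>Types of automorphisms\<close>

definition vdist :: "('v, 'e) pre_digraph \<Rightarrow> 'v \<Rightarrow> 'v \<Rightarrow> nat" where
  "vdist T x y = (LEAST n. \<exists>p. pre_digraph.awalk T x p y \<and> length p = n)"

definition tlength :: "('v, 'e) pre_digraph \<Rightarrow> ('v \<Rightarrow> 'v) \<times> ('e \<Rightarrow> 'e) \<Rightarrow> nat" where
  "tlength T g = (LEAST n. \<exists>x\<in>verts T. vdist T x (fst g x) = n)"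

definition min_verts :: "('v, 'e) pre_digraph \<Rightarrow> ('v \<Rightarrow> 'v) \<times> ('e \<Rightarrow> 'e) \<Rightarrow> 'v set" where
  "min_verts T g = {x \<in> verts T. vdist T x (fst g x) = tlength T g}"

definition elliptic :: "('v, 'e) pre_digraph \<Rightarrow> ('v \<Rightarrow> 'v) \<times> ('e \<Rightarrow> 'e) \<Rightarrow> bool" where
  "elliptic T g \<longleftrightarrow> tlength T g = 0"

definition hyperbolic :: "('v, 'e) pre_digraph \<Rightarrow> ('v \<Rightarrow> 'v) \<times> ('e \<Rightarrow> 'e) \<Rightarrow> bool" where
  "hyperbolic T g \<longleftrightarrow> tlength T g > 0 \<and> infinite (min_verts T g)"

text \<open>
  An element with positive minimal displacement attained at only finitely many vertices maps some
  edge to its inverse; its minimal displacement is then 1.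
\<close>
definition tree_inversion :: "('v, 'e) pre_digraph \<Rightarrow> ('v \<Rightarrow> 'v) \<times> ('e \<Rightarrow> 'e) \<Rightarrow> bool" where
  "tree_inversion T g \<longleftrightarrow> tlength T g > 0 \<and> finite (min_verts T g)"

definition edge_fixating :: "('v, 'e) pre_digraph \<Rightarrow> ('v \<Rightarrow> 'v) \<times> ('e \<Rightarrow> 'e) \<Rightarrow> bool" where
  "edge_fixating T g \<longleftrightarrow> (\<exists>e\<in>arcs T. snd g e = e)"

end

theory Submission
  imports Defs
begin

text \<open>
  The quasi-center \<open>Q\<close> of \<open>H\<close> is a normal subgroup of \<open>H\<close>, and each of its elements commutes with the
  pointwise fixator in \<open>H\<close> of some finite set of arcs. Hence any finitely many elements of \<open>Q\<close> commute
  with one such fixator. If these elements generate a group that moves every vertex into a fixed finite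
  set \<open>B\<close>, then an element commuting with them and fixing the arcs at \<open>B\<close> fixes everything, so that a
  finite set of arcs has trivial fixator and \<open>H\<close> is discrete. By connectedness it is enough that every
  neighbour of \<open>B\<close> is moved into \<open>B\<close> by some element of \<open>Q\<close>; this is \<open>discrete_if_QZ_cobounded\<close>. Each part
  of the theorem is proved by finding such a set \<open>B\<close> from a forbidden element \<open>h\<close> of \<open>Q\<close>.

  \<^item> If \<open>h \<noteq> 1\<close> is elliptic, it acts non-trivially on the arcs at some vertex \<open>x\<close> that it fixes; if it fixes
    an arc, then \<open>x\<close> can be chosen such that \<open>h\<close> also fixes an arc at \<open>x\<close>. The local action of \<open>Q\<close> at \<open>x\<close> is
    normal in that of \<open>H\<close>, so quasiprimitivity, respectively semiprimitivity, makes it transitive. The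
    same then holds at all neighbours of a neighbour \<open>y\<close> of \<open>x\<close>, and the star of \<open>y\<close> serves as \<open>B\<close>
    (\<open>discrete_if_QZ_transitive_at\<close>).

  \<^item> If \<open>h\<close> has minimal displacement \<open>k > 0\<close>, attained at \<open>x\<close>, and the stabilizer of \<open>x\<close> in \<open>H\<close> is transitive
    on non-backtracking paths of length \<open>k\<close> from \<open>x\<close>, then the ball of radius \<open>k\<close> around \<open>x\<close> serves as \<open>B\<close>
    (\<open>discrete_if_path_transitive\<close>). This covers hyperbolic elements, and also inversions: in a tree, an
    automorphism whose displacement is minimal at only finitely many vertices has displacement at
    most 1 (\<open>infinite_min_verts\<close>), and local transitivity is transitivity on paths of length 1.
\<close>

section \<open>Automorphisms of a graph\<close>

lemma BijGroup_carrier: "carrier (BijGroup S) = Bij S"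
  by (simp add: BijGroup_def)

lemma inv_BijGroup_pair:
  assumes "\<phi> \<in> Bij A" "\<psi> \<in> Bij B"
  shows "inv\<^bsub>BijGroup A \<times>\<times> BijGroup B\<^esub> (\<phi>,\<psi>) = (restrict (inv_into A \<phi>) A, restrict (inv_into B \<psi>) B)"
proof -
  have 1: "\<phi> \<in> carrier (BijGroup A)" using assms by (simp only: BijGroup_carrier)
  have 2: "\<psi> \<in> carrier (BijGroup B)" using assms by (simp only: BijGroup_carrier)
  have "inv\<^bsub>BijGroup A \<times>\<times> BijGroup B\<^esub> (\<phi>,\<psi>) = (inv\<^bsub>BijGroup A\<^esub> \<phi>, inv\<^bsub>BijGroup B\<^esub> \<psi>)"
    by (rule inv_DirProd[OF group_BijGroup group_BijGroup 1 2])
  then show ?thesis by (simp only: inv_BijGroup assms)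
qed

context bidirected_digraph
begin

text \<open>
  \<open>tree_auts\<close> is cut out of a product of two bijection groups by compatibility conditions, so that it
  inherits their group laws. Everything later uses inverses formed in \<open>Aut\<close>, which only mean inverse
  maps once this is known.
\<close>

lemma tree_auts_subgroup:
  "subgroup (tree_auts G arev) (BijGroup (verts G) \<times>\<times> BijGroup (arcs G))"
proof -
  let ?V = "BijGroup (verts G)" and ?E = "BijGroup (arcs G)"
  interpret V: group ?V by (rule group_BijGroup)
  interpret E: group ?E by (rule group_BijGroup)
  interpret VE: group "?V \<times>\<times> ?E" by (rule DirProd_group) unfold_locales
  show ?thesis
  proof (rule VE.subgroupI)
    show "tree_auts G arev \<subseteq> carrier (?V \<times>\<times> ?E)"
      by (auto simp: tree_auts_def BijGroup_def)
    have "(\<lambda>x\<in>verts G. x, \<lambda>e\<in>arcs G. e) \<in> tree_auts G arev"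
      by (auto simp: tree_auts_def id_Bij)
    then show "tree_auts G arev \<noteq> {}" by blast
  next
    fix g assume g: "g \<in> tree_auts G arev"
    obtain \<phi> \<psi> where gp: "g = (\<phi>, \<psi>)" by (cases g)
    have B: "\<phi> \<in> Bij (verts G)" "\<psi> \<in> Bij (arcs G)" using g gp by (auto simp: tree_auts_def)
    have bv: "bij_betw \<phi> (verts G) (verts G)" and be: "bij_betw \<psi> (arcs G) (arcs G)"
      using B by (auto simp: Bij_def)
    let ?\<phi> = "\<lambda>x\<in>verts G. inv_into (verts G) \<phi> x"
    let ?\<psi> = "\<lambda>e\<in>arcs G. inv_into (arcs G) \<psi> e"
    have inv_eq: "inv\<^bsub>?V \<times>\<times> ?E\<^esub> g = (?\<phi>, ?\<psi>)"
      unfolding gp by (rule inv_BijGroup_pair[OF B])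
    have "(?\<phi>, ?\<psi>) \<in> tree_auts G arev"
      unfolding tree_auts_def
    proof (intro CollectI conjI ballI)
      show "(?\<phi>, ?\<psi>) \<in> Bij (verts G) \<times> Bij (arcs G)" by (simp add: B restrict_inv_into_Bij)
      fix e assume "e \<in> arcs G"
      then obtain f where f: "f \<in> arcs G" "e = \<psi> f" using be by (auto simp: bij_betw_def)
      have *: "tail G e = \<phi> (tail G f)" "head G e = \<phi> (head G f)" "arev e = \<psi> (arev f)"
        using g gp f by (auto simp: tree_auts_def)
      have inj: "inj_on \<phi> (verts G)" "inj_on \<psi> (arcs G)" using bv be by (auto simp: bij_betw_def)
      have \<psi>in: "\<And>a. a \<in> arcs G \<Longrightarrow> \<psi> a \<in> arcs G" using be by (auto simp: bij_betw_def)
      have \<phi>in: "\<And>a. a \<in> verts G \<Longrightarrow> \<phi> a \<in> verts G" using bv by (auto simp: bij_betw_def)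
      show "tail G (snd (?\<phi>, ?\<psi>) e) = fst (?\<phi>, ?\<psi>) (tail G e)"
        unfolding * using f inj \<psi>in \<phi>in by simp
      show "head G (snd (?\<phi>, ?\<psi>) e) = fst (?\<phi>, ?\<psi>) (head G e)"
        unfolding * using f inj \<psi>in \<phi>in by simp
      show "snd (?\<phi>, ?\<psi>) (arev e) = arev (snd (?\<phi>, ?\<psi>) e)"
        unfolding * using f inj \<psi>in \<phi>in by simp
    qed
    then show "inv\<^bsub>?V \<times>\<times> ?E\<^esub> g \<in> tree_auts G arev" using inv_eq by simp
  next
    fix g h assume g: "g \<in> tree_auts G arev" and h: "h \<in> tree_auts G arev"
    have Bh: "fst h \<in> Bij (verts G)" "snd h \<in> Bij (arcs G)" using h by (auto simp: tree_auts_def)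
    have hin: "\<And>x. x \<in> verts G \<Longrightarrow> fst h x \<in> verts G" "\<And>e. e \<in> arcs G \<Longrightarrow> snd h e \<in> arcs G"
      using Bh by (auto dest: Bij_imp_funcset)
    have "g \<otimes>\<^bsub>?V \<times>\<times> ?E\<^esub> h = (compose (verts G) (fst g) (fst h), compose (arcs G) (snd g) (snd h))"
      using g h by (auto simp: mult_DirProd' BijGroup_def tree_auts_def)
    then show "g \<otimes>\<^bsub>?V \<times>\<times> ?E\<^esub> h \<in> tree_auts G arev"
      using g h hin by (auto simp: tree_auts_def compose_Bij compose_eq)
  qed
qed

lemma Aut_group: "group (Aut G arev)"
  unfolding Aut_def
  by (intro group.subgroup_imp_group DirProd_group group_BijGroup tree_auts_subgroup)

lemma carrier_Aut [simp]: "carrier (Aut G arev) = tree_auts G arev"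
  by (simp add: Aut_def)

abbreviation aut_mult (infixl "\<odot>" 70) where "g \<odot> h \<equiv> g \<otimes>\<^bsub>Aut G arev\<^esub> h"
abbreviation aut_one ("\<one>\<^sub>A") where "\<one>\<^sub>A \<equiv> \<one>\<^bsub>Aut G arev\<^esub>"
abbreviation aut_inv ("inv\<^sub>A _" [81] 80) where "inv\<^sub>A g \<equiv> inv\<^bsub>Aut G arev\<^esub> g"

sublocale Aut: group "Aut G arev" by (rule Aut_group)

lemmas aut_closed = Aut.m_closed[simplified] Aut.inv_closed[simplified] Aut.one_closed[simplified]

lemma aut_Bij:
  assumes "g \<in> tree_auts G arev"
  shows "fst g \<in> Bij (verts G)" and "snd g \<in> Bij (arcs G)"
  using assms by (auto simp: tree_auts_def)

lemma aut_in:
  assumes "g \<in> tree_auts G arev"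
  shows "x \<in> verts G \<Longrightarrow> fst g x \<in> verts G" and "e \<in> arcs G \<Longrightarrow> snd g e \<in> arcs G"
  using aut_Bij[OF assms] by (auto dest: Bij_imp_funcset[THEN funcset_mem])

lemma aut_graph [simp]:
  assumes "g \<in> tree_auts G arev" "e \<in> arcs G"
  shows "tail G (snd g e) = fst g (tail G e)"
    and "head G (snd g e) = fst g (head G e)"
    and "snd g (arev e) = arev (snd g e)"
  using assms by (auto simp: tree_auts_def)

lemma aut_mult_apply:
  assumes "g \<in> tree_auts G arev" "h \<in> tree_auts G arev"
  shows "x \<in> verts G \<Longrightarrow> fst (g \<odot> h) x = fst g (fst h x)"
    and "e \<in> arcs G \<Longrightarrow> snd (g \<odot> h) e = snd g (snd h e)"
proof -
  have "g \<odot> h = (compose (verts G) (fst g) (fst h), compose (arcs G) (snd g) (snd h))"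
    using aut_Bij[OF assms(1)] aut_Bij[OF assms(2)]
    by (simp add: Aut_def mult_DirProd' BijGroup_def)
  then show "x \<in> verts G \<Longrightarrow> fst (g \<odot> h) x = fst g (fst h x)"
    and "e \<in> arcs G \<Longrightarrow> snd (g \<odot> h) e = snd g (snd h e)"
    by (auto simp: compose_eq)
qed

lemma aut_one_apply:
  shows "x \<in> verts G \<Longrightarrow> fst \<one>\<^sub>A x = x" and "e \<in> arcs G \<Longrightarrow> snd \<one>\<^sub>A e = e"
  by (auto simp: Aut_def DirProd_def BijGroup_def)

lemma aut_inv_apply:
  assumes "g \<in> tree_auts G arev"
  shows "x \<in> verts G \<Longrightarrow> fst (inv\<^sub>A g) (fst g x) = x"
    and "x \<in> verts G \<Longrightarrow> fst g (fst (inv\<^sub>A g) x) = x"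
    and "e \<in> arcs G \<Longrightarrow> snd (inv\<^sub>A g) (snd g e) = e"
    and "e \<in> arcs G \<Longrightarrow> snd g (snd (inv\<^sub>A g) e) = e"
proof -
  have l: "(inv\<^sub>A g) \<odot> g = \<one>\<^sub>A" and r: "g \<odot> (inv\<^sub>A g) = \<one>\<^sub>A" and i: "inv\<^sub>A g \<in> tree_auts G arev"
    using assms by (simp_all add: aut_closed)
  show "x \<in> verts G \<Longrightarrow> fst (inv\<^sub>A g) (fst g x) = x" "e \<in> arcs G \<Longrightarrow> snd (inv\<^sub>A g) (snd g e) = e"
    using aut_mult_apply[OF i assms] unfolding l by (auto simp: aut_one_apply)
  show "x \<in> verts G \<Longrightarrow> fst g (fst (inv\<^sub>A g) x) = x" "e \<in> arcs G \<Longrightarrow> snd g (snd (inv\<^sub>A g) e) = e"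
    using aut_mult_apply[OF assms i] unfolding r by (auto simp: aut_one_apply)
qed

lemma aut_eqI:
  assumes "g \<in> tree_auts G arev" "h \<in> tree_auts G arev"
    and "\<And>x. x \<in> verts G \<Longrightarrow> fst g x = fst h x" "\<And>e. e \<in> arcs G \<Longrightarrow> snd g e = snd h e"
  shows "g = h"
proof (rule prod_eqI)
  show "fst g = fst h"
    using aut_Bij[OF assms(1)] aut_Bij[OF assms(2)] assms(3)
    by (intro extensionalityI[of _ "verts G"]) (auto simp: Bij_def)
  show "snd g = snd h"
    using aut_Bij[OF assms(1)] aut_Bij[OF assms(2)] assms(4)
    by (intro extensionalityI[of _ "arcs G"]) (auto simp: Bij_def)
qed

lemma awalk_map_aut:
  assumes "g \<in> tree_auts G arev" "awalk x p y"
  shows "awalk (fst g x) (map (snd g) p) (fst g y)"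
  using assms(2)
  by (induction p arbitrary: x) (auto simp: awalk_Cons_iff awalk_Nil_iff assms(1) aut_in)

end

section \<open>Connected graphs without leaves\<close>

text \<open>
  Since an infinite set has cardinality 0, the bound on \<open>card\<close> also makes the graph locally finite.
  With at least two arcs at each vertex, 2-transitivity of a local action implies its transitivity; this
  is what turns local 2-transitivity into transitivity on paths of length 2.
\<close>

locale leafless_graph = bidirected_digraph +
  assumes connected: "strongly_connected G"
    and degree_ge_2: "x \<in> verts G \<Longrightarrow> 2 \<le> card (out_arcs G x)"
begin

lemma finite_out: "x \<in> verts G \<Longrightarrow> finite (out_arcs G x)"
  using degree_ge_2[of x] by (metis card.infinite not_numeral_le_zero)

lemma exists_out_arc:
  assumes "x \<in> verts G"
  obtains e where "e \<in> arcs G" "tail G e = x"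
proof -
  have "out_arcs G x \<noteq> {}" using degree_ge_2[OF assms] by auto
  then obtain e where "e \<in> out_arcs G x" by blast
  then show thesis using that[of e] by simp
qed

lemma exists_walk:
  assumes "x \<in> verts G" "y \<in> verts G"
  obtains p where "awalk x p y"
  using connected assms by (auto simp: strongly_connected_def reachable_awalk)

text \<open>
  Connectedness is used in this form throughout: a property of vertices that passes along arcs and
  holds once, holds everywhere.
\<close>

lemma connected_induct:
  assumes "x \<in> verts G" "P x" "y \<in> verts G"
    and step: "\<And>e. e \<in> arcs G \<Longrightarrow> P (tail G e) \<Longrightarrow> P (head G e)"
  shows "P y"
proof -
  obtain p where "awalk x p y" using exists_walk assms by blast
  then show ?thesis using \<open>P x\<close>
    by (induction p arbitrary: x) (auto simp: awalk_Cons_iff awalk_Nil_iff dest: step)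
qed

text \<open>
  Every vertex is the origin of some arc, so the action on arcs determines the action on vertices.
\<close>

lemma aut_eq_oneI:
  assumes g: "g \<in> tree_auts G arev" and "\<And>e. e \<in> arcs G \<Longrightarrow> snd g e = e"
  shows "g = \<one>\<^sub>A"
proof (rule aut_eqI[OF g aut_closed(3)])
  show "snd g e = snd \<one>\<^sub>A e" if "e \<in> arcs G" for e
    using that assms by (simp add: aut_one_apply)
  show "fst g x = fst \<one>\<^sub>A x" if x: "x \<in> verts G" for x
  proof -
    obtain e where e: "e \<in> arcs G" "tail G e = x" using exists_out_arc[OF x] .
    then have "fst g x = tail G (snd g e)" using g by simp
    then show ?thesis using e assms x by (simp add: aut_one_apply)
  qed
qed

text \<open>
  If every fixed vertex had all its arcs fixed, the set of fixed vertices would spread to neighbours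
  and \<open>h\<close> would be trivial. This is how a non-trivial elliptic element produces a non-trivial element of
  a local action.
\<close>

lemma moved_arc_at_fixed_vertex:
  assumes h: "h \<in> tree_auts G arev" "h \<noteq> \<one>\<^sub>A" and x: "x \<in> verts G" "fst h x = x"
  shows "\<exists>y\<in>verts G. fst h y = y \<and> (\<exists>f\<in>out_arcs G y. snd h f \<noteq> f)"
proof (rule ccontr)
  assume "\<not> ?thesis"
  then have fixed: "snd h f = f" if "f \<in> arcs G" "fst h (tail G f) = tail G f" for f
    using that that(1)[THEN tail_in_verts] by auto
  have "fst h y = y" if "y \<in> verts G" for y
    using x(1) x(2) that
  proof (rule connected_induct)
    fix e assume e: "e \<in> arcs G" "fst h (tail G e) = tail G e"
    then show "fst h (head G e) = head G e" using fixed[OF e] aut_graph(2)[OF h(1) e(1)] by simp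
  qed
  then have "h = \<one>\<^sub>A" using fixed h(1) by (intro aut_eq_oneI) auto
  with h(2) show False ..
qed

text \<open>
  Same spreading argument, for the property that all arcs at a vertex are fixed. The outcome is a
  non-trivial element of a local action with a fixed point, which witnesses a failure of semiregularity.
\<close>

lemma moved_arc_beside_fixed_arc:
  assumes h: "h \<in> tree_auts G arev" "h \<noteq> \<one>\<^sub>A" and e: "e \<in> arcs G" "snd h e = e"
  shows "\<exists>y\<in>verts G. (\<exists>f\<in>out_arcs G y. snd h f = f) \<and> (\<exists>f\<in>out_arcs G y. snd h f \<noteq> f)"
proof (rule ccontr)
  assume no_such_vertex: "\<not> ?thesis"
  have spread: "snd h f' = f'"
    if "f \<in> arcs G" "snd h f = f" "f' \<in> arcs G" "tail G f' = tail G f" for f f'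
  proof -
    have "tail G f \<in> verts G" "f \<in> out_arcs G (tail G f)" "f' \<in> out_arcs G (tail G f)"
      using that by auto
    then show ?thesis using no_such_vertex that(2) by blast
  qed
  let ?P = "\<lambda>y. \<forall>f\<in>out_arcs G y. snd h f = f"
  have all: "?P y" if "y \<in> verts G" for y
  proof (rule connected_induct[of "tail G e" ?P])
    show "tail G e \<in> verts G" using e by simp
    show "?P (tail G e)" using spread[OF e] by auto
    show "y \<in> verts G" by fact
    fix a assume a: "a \<in> arcs G" "?P (tail G a)"
    then have "snd h (arev a) = arev a" using aut_graph(3)[OF h(1) a(1)] by auto
    then show "?P (head G a)" using spread[of "arev a"] a(1) by auto
  qed
  have "h = \<one>\<^sub>A"
  proof (rule aut_eq_oneI[OF h(1)])
    fix a assume "a \<in> arcs G"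
    then show "snd h a = a" using all[of "tail G a"] by simp
  qed
  with h(2) show False ..
qed

text \<open>
  Basic open sets may prescribe images of vertices as well; choosing an arc with origin at each such
  vertex turns these conditions into conditions on arcs, so arcs alone give neighbourhood bases.
\<close>

lemma openin_perm_topology_D:
  assumes "openin (perm_topology G arev) U" "u \<in> U"
  shows "\<exists>F. finite F \<and> F \<subseteq> arcs G \<and> {h \<in> tree_auts G arev. \<forall>e\<in>F. snd h e = snd u e} \<subseteq> U"
proof -
  have "\<forall>u\<in>U. u \<in> tree_auts G arev \<and>
    (\<exists>F. finite F \<and> F \<subseteq> arcs G \<and> {h \<in> tree_auts G arev. \<forall>e\<in>F. snd h e = snd u e} \<subseteq> U)"
    using assms(1) unfolding perm_topology_def openin_topology_generated_by_iff
  proof (induction rule: generate_topology_on.induct)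
    case Empty
    then show ?case by simp
  next
    case (Int a b)
    show ?case
    proof
      fix u assume u: "u \<in> a \<inter> b"
      obtain F1 where F1: "u \<in> tree_auts G arev" "finite F1" "F1 \<subseteq> arcs G"
          "{h \<in> tree_auts G arev. \<forall>e\<in>F1. snd h e = snd u e} \<subseteq> a"
        using bspec[OF Int.IH(1), of u] u by auto
      obtain F2 where F2: "finite F2" "F2 \<subseteq> arcs G"
          "{h \<in> tree_auts G arev. \<forall>e\<in>F2. snd h e = snd u e} \<subseteq> b"
        using bspec[OF Int.IH(2), of u] u by auto
      have "{h \<in> tree_auts G arev. \<forall>e\<in>F1 \<union> F2. snd h e = snd u e} \<subseteq> a \<inter> b"
        using F1(4) F2(3) by auto
      then show "u \<in> tree_auts G arev \<and> (\<exists>F. finite F \<and> F \<subseteq> arcs G \<and>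
          {h \<in> tree_auts G arev. \<forall>e\<in>F. snd h e = snd u e} \<subseteq> a \<inter> b)"
        using F1(1-3) F2(1,2) by (intro conjI exI[of _ "F1 \<union> F2"]) simp_all
    qed
  next
    case (UN K)
    show ?case
    proof
      fix u assume "u \<in> \<Union>K"
      then obtain k where k: "k \<in> K" "u \<in> k" by blast
      then obtain F where F: "u \<in> tree_auts G arev" "finite F" "F \<subseteq> arcs G"
          "{h \<in> tree_auts G arev. \<forall>e\<in>F. snd h e = snd u e} \<subseteq> k"
        using bspec[OF UN.IH[OF k(1)], of u] by auto
      have "{h \<in> tree_auts G arev. \<forall>e\<in>F. snd h e = snd u e} \<subseteq> \<Union>K" using F(4) k(1) by blast
      then show "u \<in> tree_auts G arev \<and> (\<exists>F. finite F \<and> F \<subseteq> arcs G \<and>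
          {h \<in> tree_auts G arev. \<forall>e\<in>F. snd h e = snd u e} \<subseteq> \<Union>K)"
        using F(1-3) by blast
    qed
  next
    case (Basis s)
    then obtain g A B
      where s: "s = {h \<in> tree_auts G arev. (\<forall>x\<in>A. fst h x = fst g x) \<and> (\<forall>e\<in>B. snd h e = snd g e)}"
        and AB: "finite A" "A \<subseteq> verts G" "finite B" "B \<subseteq> arcs G"
      by (elim CollectE exE conjE) (rule that)
    have "\<forall>x\<in>A. \<exists>e. e \<in> arcs G \<and> tail G e = x" using exists_out_arc AB(2) by blast
    then obtain c where c: "\<And>x. x \<in> A \<Longrightarrow> c x \<in> arcs G \<and> tail G (c x) = x" by metis
    show ?case
    proof
      fix u assume u: "u \<in> s"
      have "h \<in> s" if h: "h \<in> tree_auts G arev" "\<forall>e\<in>B \<union> c ` A. snd h e = snd u e" for h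
      proof -
        have "fst h x = fst g x" if "x \<in> A" for x
        proof -
          have "fst h x = tail G (snd h (c x))" using h(1) c[OF that] by simp
          also have "\<dots> = tail G (snd u (c x))" using h(2) that by simp
          also have "\<dots> = fst u x" using u s c[OF that] by simp
          finally show ?thesis using u s that by simp
        qed
        then show ?thesis using h u s by simp
      qed
      then have "{h \<in> tree_auts G arev. \<forall>e\<in>B \<union> c ` A. snd h e = snd u e} \<subseteq> s"
        by (intro subsetI) simp
      moreover have "B \<union> c ` A \<subseteq> arcs G" using AB c by auto
      moreover have "u \<in> tree_auts G arev" using u s by simp
      ultimately show "u \<in> tree_auts G arev \<and> (\<exists>F. finite F \<and> F \<subseteq> arcs G \<and>
          {h \<in> tree_auts G arev. \<forall>e\<in>F. snd h e = snd u e} \<subseteq> s)"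
        using AB(1,3) by (intro conjI exI[of _ "B \<union> c ` A"]) simp_all
    qed
  qed
  then show ?thesis using assms(2) by simp
qed

end

section \<open>The quasi-center via finite sets of arcs\<close>

locale leafless_graph_action = leafless_graph +
  fixes H :: "(('a \<Rightarrow> 'a) \<times> ('b \<Rightarrow> 'b)) set"
  assumes subgroup_H: "subgroup H (Aut G arev)"
begin

lemma H_aut [simp]: "h \<in> H \<Longrightarrow> h \<in> tree_auts G arev"
  using subgroup.subset[OF subgroup_H] by auto

lemma H_closed [simp]:
  shows "g \<in> H \<Longrightarrow> h \<in> H \<Longrightarrow> g \<odot> h \<in> H" and "h \<in> H \<Longrightarrow> inv\<^sub>A h \<in> H" and "\<one>\<^sub>A \<in> H"
  using subgroup_H by (auto intro: subgroup.m_closed subgroup.m_inv_closed subgroup.one_closed)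

lemma openin_H_iff:
  assumes "U \<subseteq> H"
  shows "openin (subtopology (perm_topology G arev) H) U \<longleftrightarrow>
    (\<forall>u\<in>U. \<exists>F. finite F \<and> F \<subseteq> arcs G \<and> {h \<in> H. \<forall>e\<in>F. snd h e = snd u e} \<subseteq> U)"
    (is "?open \<longleftrightarrow> ?nbhd")
proof
  assume ?open
  then obtain W where W: "openin (perm_topology G arev) W" "U = W \<inter> H"
    by (auto simp: openin_subtopology)
  show ?nbhd
  proof
    fix u assume "u \<in> U"
    then have "u \<in> W" using W(2) by simp
    from openin_perm_topology_D[OF W(1) this] obtain F where F: "finite F" "F \<subseteq> arcs G"
        "{h \<in> tree_auts G arev. \<forall>e\<in>F. snd h e = snd u e} \<subseteq> W"
      by auto
    have "{h \<in> H. \<forall>e\<in>F. snd h e = snd u e} \<subseteq> U" using F(3) W(2) by auto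
    then show "\<exists>F. finite F \<and> F \<subseteq> arcs G \<and> {h \<in> H. \<forall>e\<in>F. snd h e = snd u e} \<subseteq> U"
      using F(1,2) by (intro exI[of _ F] conjI)
  qed
next
  assume nbhd: ?nbhd
  show ?open
  proof (subst openin_subopen, intro ballI)
    fix u assume u: "u \<in> U"
    from bspec[OF nbhd u] obtain F where F: "finite F" "F \<subseteq> arcs G"
        "{h \<in> H. \<forall>e\<in>F. snd h e = snd u e} \<subseteq> U"
      by auto
    let ?W = "{h \<in> tree_auts G arev. (\<forall>x\<in>{}. fst h x = fst u x) \<and> (\<forall>e\<in>F. snd h e = snd u e)}"
    have uaut: "u \<in> tree_auts G arev" using u assms by auto
    have "openin (perm_topology G arev) ?W"
      unfolding perm_topology_def using F uaut
      by (intro topology_generated_by_Basis CollectI exI[of _ u] exI[of _ "{}"] exI[of _ F]) auto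
    then have "openin (subtopology (perm_topology G arev) H) (?W \<inter> H)"
      by (auto simp: openin_subtopology)
    moreover have "u \<in> ?W \<inter> H" using u uaut assms by auto
    moreover have "?W \<inter> H \<subseteq> U" using F(3) by auto
    ultimately show "\<exists>V. openin (subtopology (perm_topology G arev) H) V \<and> u \<in> V \<and> V \<subseteq> U" by blast
  qed
qed

lemma inv_mult_fixes:
  assumes "u \<in> H" "v \<in> H" "F \<subseteq> arcs G" "\<forall>e\<in>F. snd v e = snd u e"
  shows "\<forall>e\<in>F. snd ((inv\<^sub>A u) \<odot> v) e = e"
  using assms by (auto simp: aut_mult_apply aut_closed aut_inv_apply subset_iff)

lemma mult_inv_cancel:
  assumes "u \<in> H" "v \<in> H"
  shows "u \<odot> ((inv\<^sub>A u) \<odot> v) = v" and "(inv\<^sub>A u) \<odot> (u \<odot> v) = v"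
  using assms by (simp_all add: Aut.m_assoc[symmetric] aut_closed)

text \<open>
  If the fixator of a finite set \<open>F\<close> of arcs is trivial, an element is determined by its values on \<open>F\<close>,
  which makes every point open.
\<close>

lemma discreteI:
  assumes F: "finite F" "F \<subseteq> arcs G"
    and trivial: "\<And>g. g \<in> H \<Longrightarrow> \<forall>e\<in>F. snd g e = e \<Longrightarrow> g = \<one>\<^sub>A"
  shows "subtopology (perm_topology G arev) H = discrete_topology H"
proof -
  have sing: "v = u" if "u \<in> H" "v \<in> H" "\<forall>e\<in>F. snd v e = snd u e" for u v
  proof -
    have "(inv\<^sub>A u) \<odot> v = \<one>\<^sub>A" using that F by (intro trivial inv_mult_fixes) simp_all
    then show ?thesis using mult_inv_cancel(1)[OF that(1,2)] that(1) by simp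
  qed
  have "openin (subtopology (perm_topology G arev) H) U" if U: "U \<subseteq> H" for U
    unfolding openin_H_iff[OF U]
  proof
    fix u assume u: "u \<in> U"
    have "{h \<in> H. \<forall>e\<in>F. snd h e = snd u e} \<subseteq> U"
      using sing[OF subsetD[OF U u]] u by auto
    then show "\<exists>F. finite F \<and> F \<subseteq> arcs G \<and> {h \<in> H. \<forall>e\<in>F. snd h e = snd u e} \<subseteq> U"
      using F by (intro exI[of _ F] conjI)
  qed
  moreover have "U \<subseteq> H" if "openin (subtopology (perm_topology G arev) H) U" for U
    using openin_subset[OF that] by auto
  ultimately show ?thesis by (auto simp: topology_eq)
qed

text \<open>
  Membership in the quasi-center without topology: the centralizer is a subgroup, so it is open as
  soon as it is a neighbourhood of the identity, that is, contains the fixator of finitely many arcs.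
\<close>

lemma QZ_iff:
  "h \<in> QZ G arev H \<longleftrightarrow> h \<in> H \<and>
     (\<exists>F. finite F \<and> F \<subseteq> arcs G \<and> (\<forall>g\<in>H. (\<forall>e\<in>F. snd g e = e) \<longrightarrow> g \<odot> h = h \<odot> g))"
proof (cases "h \<in> H")
  case True
  let ?C = "{g \<in> H. g \<odot> h = h \<odot> g}"
  have "h \<in> QZ G arev H \<longleftrightarrow> openin (subtopology (perm_topology G arev) H) ?C"
    using True by (simp add: QZ_def quasi_center_def centralizer_of_def)
  also have "\<dots> \<longleftrightarrow> (\<forall>u\<in>?C. \<exists>F. finite F \<and> F \<subseteq> arcs G \<and> {g \<in> H. \<forall>e\<in>F. snd g e = snd u e} \<subseteq> ?C)"
    by (rule openin_H_iff) auto
  also have "\<dots> \<longleftrightarrow> (\<exists>F. finite F \<and> F \<subseteq> arcs G \<and> (\<forall>g\<in>H. (\<forall>e\<in>F. snd g e = e) \<longrightarrow> g \<odot> h = h \<odot> g))"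
    (is "?nbhd \<longleftrightarrow> ?fix")
  proof
    assume ?nbhd
    moreover have "\<one>\<^sub>A \<in> ?C" using True by simp
    ultimately have "\<exists>F. finite F \<and> F \<subseteq> arcs G \<and> {g \<in> H. \<forall>e\<in>F. snd g e = snd \<one>\<^sub>A e} \<subseteq> ?C"
      by (rule bspec)
    then obtain F where F: "finite F" "F \<subseteq> arcs G" "{g \<in> H. \<forall>e\<in>F. snd g e = snd \<one>\<^sub>A e} \<subseteq> ?C"
      by auto
    then have "\<forall>g\<in>H. (\<forall>e\<in>F. snd g e = e) \<longrightarrow> g \<odot> h = h \<odot> g"
      by (auto simp: aut_one_apply subset_iff)
    with F show ?fix by (intro exI[of _ F] conjI)
  next
    assume ?fix
    then obtain F where F: "finite F" "F \<subseteq> arcs G"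
      and comm: "\<And>g. g \<in> H \<Longrightarrow> \<forall>e\<in>F. snd g e = e \<Longrightarrow> g \<odot> h = h \<odot> g" by blast
    have commutes: "g \<odot> h = h \<odot> g" if u: "u \<in> ?C" and g: "g \<in> H" "\<forall>e\<in>F. snd g e = snd u e" for u g
    proof -
      let ?w = "(inv\<^sub>A u) \<odot> g"
      have H: "u \<in> H" "?w \<in> H" "h \<in> H" using u g True by simp_all
      have w: "?w \<odot> h = h \<odot> ?w" using H g F by (intro comm inv_mult_fixes) simp_all
      have "(u \<odot> ?w) \<odot> h = h \<odot> (u \<odot> ?w)"
        using H u w by (simp add: Aut.m_assoc) (simp add: Aut.m_assoc[symmetric])
      then show ?thesis using mult_inv_cancel(1)[OF H(1) g(1)] by simp
    qed
    have "{g \<in> H. \<forall>e\<in>F. snd g e = snd u e} \<subseteq> ?C" if u: "u \<in> ?C" for u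
    proof
      fix g assume "g \<in> {g \<in> H. \<forall>e\<in>F. snd g e = snd u e}"
      then show "g \<in> ?C" using commutes[OF u, of g] by simp
    qed
    then show ?nbhd using F(1,2) by (intro ballI exI[of _ F] conjI)
  qed
  finally show ?thesis using True by simp
qed (simp add: QZ_def quasi_center_def)

lemma QZ_subset: "h \<in> QZ G arev H \<Longrightarrow> h \<in> H"
  by (simp add: QZ_iff)

lemma QZ_conj:
  assumes h: "h \<in> QZ G arev H" and k: "k \<in> H"
  shows "k \<odot> h \<odot> (inv\<^sub>A k) \<in> QZ G arev H"
proof -
  obtain F where hH: "h \<in> H" and F: "finite F" "F \<subseteq> arcs G"
    and comm: "\<And>g. g \<in> H \<Longrightarrow> \<forall>e\<in>F. snd g e = e \<Longrightarrow> g \<odot> h = h \<odot> g" using h by (auto simp: QZ_iff)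
  have "g \<odot> (k \<odot> h \<odot> (inv\<^sub>A k)) = (k \<odot> h \<odot> (inv\<^sub>A k)) \<odot> g"
    if g: "g \<in> H" "\<forall>e\<in>snd k ` F. snd g e = e" for g
  proof -
    \<comment> \<open>If \<open>g\<close> fixes \<open>k F\<close>, then its conjugate \<open>w\<close> fixes \<open>F\<close> and hence commutes with \<open>h\<close>.\<close>
    define w where "w = (inv\<^sub>A k) \<odot> (g \<odot> k)"
    have H: "g \<in> H" "h \<in> H" "k \<in> H" "inv\<^sub>A k \<in> H" "w \<in> H" using g hH k by (simp_all add: w_def)
    have "\<forall>e\<in>F. snd (g \<odot> k) e = snd k e" using g F H by (auto simp: aut_mult_apply subset_iff)
    then have "\<forall>e\<in>F. snd w e = e" unfolding w_def using F H by (intro inv_mult_fixes) simp_all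
    then have w: "w \<odot> h = h \<odot> w" using H by (intro comm) simp_all
    have gk: "g \<odot> k = k \<odot> w" using mult_inv_cancel(1)[of k "g \<odot> k"] H by (simp add: w_def)
    have kg: "w \<odot> (inv\<^sub>A k) = (inv\<^sub>A k) \<odot> g" using H by (simp add: w_def Aut.m_assoc)
    have "g \<odot> (k \<odot> h \<odot> (inv\<^sub>A k)) = (g \<odot> k) \<odot> (h \<odot> (inv\<^sub>A k))" using H by (simp add: Aut.m_assoc)
    also have "\<dots> = k \<odot> (w \<odot> h) \<odot> (inv\<^sub>A k)" using H by (simp add: gk Aut.m_assoc)
    also have "\<dots> = (k \<odot> h) \<odot> (w \<odot> (inv\<^sub>A k))" using H by (simp add: w Aut.m_assoc)
    also have "\<dots> = (k \<odot> h \<odot> (inv\<^sub>A k)) \<odot> g" using H by (simp add: kg Aut.m_assoc)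
    finally show ?thesis .
  qed
  moreover have "finite (snd k ` F)" "snd k ` F \<subseteq> arcs G" using F aut_in(2)[OF H_aut[OF k]] by auto
  ultimately show ?thesis unfolding QZ_iff using hH k by (intro conjI exI[of _ "snd k ` F"]) auto
qed

lemma QZ_subgroup: "subgroup (QZ G arev H) (Aut G arev)"
proof (rule Aut.subgroupI)
  show "QZ G arev H \<subseteq> carrier (Aut G arev)" by (auto simp: QZ_iff)
  have "\<one>\<^sub>A \<in> QZ G arev H" unfolding QZ_iff by (auto intro!: exI[of _ "{}"])
  then show "QZ G arev H \<noteq> {}" by blast
next
  fix g assume "g \<in> QZ G arev H"
  then obtain F where H: "g \<in> H" and F: "finite F" "F \<subseteq> arcs G"
    and comm: "\<And>k. k \<in> H \<Longrightarrow> \<forall>e\<in>F. snd k e = e \<Longrightarrow> k \<odot> g = g \<odot> k" by (auto simp: QZ_iff)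
  have "k \<odot> (inv\<^sub>A g) = (inv\<^sub>A g) \<odot> k" if k: "k \<in> H" "\<forall>e\<in>F. snd k e = e" for k
  proof -
    have "k \<odot> (inv\<^sub>A g) = (inv\<^sub>A g) \<odot> (g \<odot> k) \<odot> (inv\<^sub>A g)"
      using mult_inv_cancel(2)[OF H k(1)] by simp
    also have "\<dots> = (inv\<^sub>A g) \<odot> (k \<odot> g) \<odot> (inv\<^sub>A g)" by (simp only: comm[OF k])
    also have "\<dots> = (inv\<^sub>A g) \<odot> k" using H k(1) by (simp add: Aut.m_assoc)
    finally show ?thesis .
  qed
  then show "inv\<^sub>A g \<in> QZ G arev H" unfolding QZ_iff using F H by auto
next
  fix g h assume "g \<in> QZ G arev H" "h \<in> QZ G arev H"
  then obtain F F' where H: "g \<in> H" "h \<in> H" and F: "finite F" "F \<subseteq> arcs G" "finite F'" "F' \<subseteq> arcs G"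
    and comm: "\<And>k. k \<in> H \<Longrightarrow> \<forall>e\<in>F. snd k e = e \<Longrightarrow> k \<odot> g = g \<odot> k"
      "\<And>k. k \<in> H \<Longrightarrow> \<forall>e\<in>F'. snd k e = e \<Longrightarrow> k \<odot> h = h \<odot> k" by (auto simp: QZ_iff)
  have "k \<odot> (g \<odot> h) = (g \<odot> h) \<odot> k" if "k \<in> H" "\<forall>e\<in>F \<union> F'. snd k e = e" for k
  proof -
    have "k \<odot> (g \<odot> h) = (g \<odot> k) \<odot> h" using comm(1)[of k] that H by (simp add: Aut.m_assoc[symmetric])
    also have "\<dots> = g \<odot> (h \<odot> k)" using comm(2)[of k] that H by (simp add: Aut.m_assoc)
    finally show ?thesis using that H by (simp add: Aut.m_assoc)
  qed
  then show "g \<odot> h \<in> QZ G arev H"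
    unfolding QZ_iff using F H by (intro conjI exI[of _ "F \<union> F'"]) auto
qed

lemma QZ_normal: "QZ G arev H \<lhd> (Aut G arev)\<lparr>carrier := H\<rparr>"
proof -
  interpret H: group "(Aut G arev)\<lparr>carrier := H\<rparr>"
    by (rule Aut.subgroup_imp_group[OF subgroup_H])
  have "subgroup (QZ G arev H) ((Aut G arev)\<lparr>carrier := H\<rparr>)"
    using QZ_subset by (intro Aut.subgroup_incl QZ_subgroup subgroup_H) auto
  then show ?thesis
    unfolding H.normal_inv_iff using QZ_conj
    by (auto simp: Aut.m_inv_consistent[OF subgroup_H])
qed


section \<open>Cobounded orbits of the quasi-center\<close>

lemma one_in_QZ: "\<one>\<^sub>A \<in> QZ G arev H"
  using QZ_subgroup by (rule subgroup.one_closed)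

text \<open>
  The engine of all four parts. The hypothesis says that a step out of \<open>B\<close> can be undone, up to
  landing elsewhere in \<open>B\<close>, by an element of the quasi-center. As \<open>B\<close> has finitely many outgoing arcs,
  finitely many elements \<open>q e\<close> suffice, so a single finite set of arcs can be chosen whose fixator
  centralizes all of them. An element \<open>g\<close> of this fixator that moreover fixes the arcs leaving \<open>B\<close> must
  be trivial: elements commuting with \<open>g\<close> bring any arc to one leaving \<open>B\<close>, and they carry arcs fixed
  by \<open>g\<close> to arcs fixed by \<open>g\<close>.
\<close>

lemma discrete_if_QZ_cobounded:
  assumes B: "finite B" "B \<noteq> {}" "B \<subseteq> verts G"
    and returns: "\<And>e. e \<in> arcs G \<Longrightarrow> tail G e \<in> B \<Longrightarrow> \<exists>q\<in>QZ G arev H. fst q (head G e) \<in> B"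
  shows "subtopology (perm_topology G arev) H = discrete_topology H"
proof -
  let ?E = "\<Union>b\<in>B. out_arcs G b"
  have E: "finite ?E" "?E \<subseteq> arcs G" using B finite_out by auto
  have "\<forall>e\<in>?E. \<exists>q\<in>QZ G arev H. fst q (head G e) \<in> B" using returns by auto
  then obtain q where q: "\<And>e. e \<in> ?E \<Longrightarrow> q e \<in> QZ G arev H \<and> fst (q e) (head G e) \<in> B"
    by metis
  have "\<forall>e\<in>?E. \<exists>F. finite F \<and> F \<subseteq> arcs G \<and> (\<forall>g\<in>H. (\<forall>f\<in>F. snd g f = f) \<longrightarrow> g \<odot> q e = q e \<odot> g)"
    using q by (simp add: QZ_iff)
  then obtain F where F: "\<And>e. e \<in> ?E \<Longrightarrow> finite (F e) \<and> F e \<subseteq> arcs G \<and>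
      (\<forall>g\<in>H. (\<forall>f\<in>F e. snd g f = f) \<longrightarrow> g \<odot> q e = q e \<odot> g)"
    by metis
  show ?thesis
  proof (rule discreteI[of "?E \<union> (\<Union>e\<in>?E. F e)"])
    show "finite (?E \<union> (\<Union>e\<in>?E. F e))" using E(1) F by blast
    show "?E \<union> (\<Union>e\<in>?E. F e) \<subseteq> arcs G" using E(2) F by blast
  next
    fix g assume g: "g \<in> H" and fixes_all: "\<forall>e\<in>?E \<union> (\<Union>e\<in>?E. F e). snd g e = e"
    have commutes: "g \<odot> q e = q e \<odot> g" if "e \<in> ?E" for e
      using F[OF that] fixes_all g that by blast
    \<comment> \<open>Using the whole centralizer of \<open>g\<close> avoids forming the subgroup generated by the \<open>q e\<close>.\<close>
    let ?P = "\<lambda>x. \<exists>c\<in>H. g \<odot> c = c \<odot> g \<and> fst c x \<in> B"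
    obtain b where b: "b \<in> B" using B by blast
    have reach: "?P x" if "x \<in> verts G" for x
    proof (rule connected_induct[of b ?P, OF _ _ that])
      show "b \<in> verts G" using b B by blast
      then show "?P b" using b g by (intro bexI[of _ "\<one>\<^sub>A"]) (simp_all add: aut_one_apply)
    next
      fix e assume e: "e \<in> arcs G" "?P (tail G e)"
      then obtain c where c: "c \<in> H" "g \<odot> c = c \<odot> g" "fst c (tail G e) \<in> B" by blast
      have ce: "snd c e \<in> arcs G" "snd c e \<in> ?E" using c e(1) aut_in(2)[OF H_aut[OF c(1)] e(1)] by auto
      let ?q = "q (snd c e)"
      have qH: "?q \<in> H" using q[OF ce(2)] QZ_subset by blast
      have "g \<odot> (?q \<odot> c) = (g \<odot> ?q) \<odot> c" using g qH c by (simp add: Aut.m_assoc)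
      also have "\<dots> = ?q \<odot> (g \<odot> c)" using g qH c commutes[OF ce(2)] by (simp add: Aut.m_assoc)
      also have "\<dots> = (?q \<odot> c) \<odot> g" using g qH c by (simp add: Aut.m_assoc)
      finally have "g \<odot> (?q \<odot> c) = (?q \<odot> c) \<odot> g" .
      moreover have "fst (?q \<odot> c) (head G e) \<in> B"
        using q[OF ce(2)] qH c e(1) by (simp add: aut_mult_apply)
      ultimately show "?P (head G e)" using qH c(1) by (intro bexI[of _ "?q \<odot> c"]) simp_all
    qed
    show "g = \<one>\<^sub>A"
    proof (rule aut_eq_oneI)
      show "g \<in> tree_auts G arev" using g by simp
      fix e assume e: "e \<in> arcs G"
      then obtain c where c: "c \<in> H" "g \<odot> c = c \<odot> g" "fst c (tail G e) \<in> B"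
        using reach[of "tail G e"] by auto
      have "snd c e \<in> ?E" using c e aut_in(2)[OF H_aut[OF c(1)] e] by auto
      then have "snd c e = snd g (snd c e)" using bspec[OF fixes_all UnI1] by simp
      also have "\<dots> = snd (g \<odot> c) e" using g c(1) e by (simp add: aut_mult_apply)
      also have "\<dots> = snd c (snd g e)" unfolding c(2) using g c(1) e by (simp add: aut_mult_apply)
      finally have "snd (inv\<^sub>A c) (snd c e) = snd (inv\<^sub>A c) (snd c (snd g e))" by simp
      then show "snd g e = e" using g c(1) e by (simp add: aut_inv_apply aut_in)
    qed
  qed
qed

section \<open>Local actions of the quasi-center\<close>

lemma vertex_stabilizer_eq: "vertex_stabilizer G arev K x = {h \<in> K. fst h x = x}"
  by (simp add: vertex_stabilizer_def stabilizer_def)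

lemma carrier_local_action:
  "carrier (local_action G arev K x) =
    (\<lambda>h. restrict (snd h) (out_arcs G x)) ` vertex_stabilizer G arev K x"
  by (simp add: local_action_def)

lemma local_action_transitiveD:
  assumes "perm_transitive (out_arcs G x) (local_action G arev K x)"
    and "e \<in> out_arcs G x" "f \<in> out_arcs G x"
  shows "\<exists>h\<in>K. fst h x = x \<and> snd h e = f"
proof -
  have "\<exists>p\<in>carrier (local_action G arev K x). p e = f"
    using transitive_action.unique_orbit[of "local_action G arev K x" "out_arcs G x"] assms
    by (simp add: perm_transitive_def)
  then obtain p where p: "p \<in> (\<lambda>h. restrict (snd h) (out_arcs G x)) ` vertex_stabilizer G arev K x"
      "p e = f"
    unfolding carrier_local_action by (rule bexE)
  from p(1) obtain h where "h \<in> vertex_stabilizer G arev K x" "p = restrict (snd h) (out_arcs G x)"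
    by (rule imageE)
  then show ?thesis using p(2) assms(2) by (intro bexI[of _ h]) (simp_all add: vertex_stabilizer_eq)
qed

lemma local_action_moves:
  assumes "h \<in> K" "fst h x = x" "f \<in> out_arcs G x" "snd h f \<noteq> f"
  shows "restrict (snd h) (out_arcs G x) \<in> carrier (local_action G arev K x)"
    and "restrict (snd h) (out_arcs G x) \<noteq> \<one>\<^bsub>BijGroup (out_arcs G x)\<^esub>"
proof -
  show "restrict (snd h) (out_arcs G x) \<in> carrier (local_action G arev K x)"
    using assms(1,2) by (simp add: local_action_def vertex_stabilizer_eq)
  have "restrict (snd h) (out_arcs G x) f \<noteq> (\<one>\<^bsub>BijGroup (out_arcs G x)\<^esub>) f"
    using assms(3,4) by (simp add: BijGroup_def)
  then show "restrict (snd h) (out_arcs G x) \<noteq> \<one>\<^bsub>BijGroup (out_arcs G x)\<^esub>" by metis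
qed

lemma restrict_aut_Bij:
  assumes h: "h \<in> tree_auts G arev" and x: "x \<in> verts G" "fst h x = x"
  shows "restrict (snd h) (out_arcs G x) \<in> Bij (out_arcs G x)"
proof -
  have "fst (inv\<^sub>A h) x = x" using aut_inv_apply(1)[OF h x(1)] x(2) by simp
  then have "bij_betw (snd h) (out_arcs G x) (out_arcs G x)"
    using x(2) h aut_closed(2)[OF h]
    by (intro bij_betw_byWitness[where f' = "snd (inv\<^sub>A h)"])
      (auto simp: aut_inv_apply aut_in)
  then show ?thesis by (simp add: Bij_def)
qed

text \<open>
  Restriction to the arcs at \<open>x\<close> is a surjection from the stabilizer of \<open>x\<close> in \<open>H\<close> onto the local
  action, and such maps preserve normality. The local action is assumed to be a group because this is
  part of \<open>perm_transitive\<close>, from which it is obtained below.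
\<close>

lemma local_action_normal:
  assumes N: "N \<lhd> (Aut G arev)\<lparr>carrier := H\<rparr>" and x: "x \<in> verts G"
    and group: "group (local_action G arev H x)"
  shows "carrier (local_action G arev N x) \<lhd> local_action G arev H x"
proof -
  interpret H: group "(Aut G arev)\<lparr>carrier := H\<rparr>"
    by (rule Aut.subgroup_imp_group[OF subgroup_H])
  let ?S = "vertex_stabilizer G arev H x" and ?\<rho> = "\<lambda>h. restrict (snd h) (out_arcs G x)"
  have NH: "N \<subseteq> H" using normal_imp_subgroup[OF N] subgroup.subset by force
  have S: "subgroup ?S ((Aut G arev)\<lparr>carrier := H\<rparr>)"
  proof (rule H.subgroupI)
    show "?S \<subseteq> carrier ((Aut G arev)\<lparr>carrier := H\<rparr>)" by (auto simp: vertex_stabilizer_eq)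
    have "\<one>\<^sub>A \<in> ?S" using x by (simp add: vertex_stabilizer_eq aut_one_apply)
    then show "?S \<noteq> {}" by blast
  next
    fix g assume g: "g \<in> ?S"
    then have "fst (inv\<^sub>A g) x = x" using aut_inv_apply(1)[of g x] x by (simp add: vertex_stabilizer_eq)
    then show "inv\<^bsub>(Aut G arev)\<lparr>carrier := H\<rparr>\<^esub> g \<in> ?S"
      using g by (simp add: vertex_stabilizer_eq Aut.m_inv_consistent[OF subgroup_H])
  next
    fix g h assume "g \<in> ?S" "h \<in> ?S"
    then show "g \<otimes>\<^bsub>(Aut G arev)\<lparr>carrier := H\<rparr>\<^esub> h \<in> ?S"
      using x by (simp add: vertex_stabilizer_eq aut_mult_apply)
  qed
  have "N \<inter> ?S \<lhd> (Aut G arev)\<lparr>carrier := ?S\<rparr>"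
    using H.normal_Int_subgroup[OF S N] by simp
  then interpret NS: normal "N \<inter> ?S" "(Aut G arev)\<lparr>carrier := ?S\<rparr>" .
  have "?\<rho> \<in> hom ((Aut G arev)\<lparr>carrier := ?S\<rparr>) (local_action G arev H x)"
  proof (rule homI)
    fix g h assume gh: "g \<in> carrier ((Aut G arev)\<lparr>carrier := ?S\<rparr>)" "h \<in> carrier ((Aut G arev)\<lparr>carrier := ?S\<rparr>)"
    then have g: "g \<in> tree_auts G arev" "fst g x = x" and h: "h \<in> tree_auts G arev" "fst h x = x"
      by (simp_all add: vertex_stabilizer_eq)
    have "?\<rho> (g \<odot> h) = compose (out_arcs G x) (?\<rho> g) (?\<rho> h)"
      using g h by (auto simp: fun_eq_iff compose_def restrict_def aut_mult_apply aut_in)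
    then show "?\<rho> (g \<otimes>\<^bsub>(Aut G arev)\<lparr>carrier := ?S\<rparr>\<^esub> h) = ?\<rho> g \<otimes>\<^bsub>local_action G arev H x\<^esub> ?\<rho> h"
      using restrict_aut_Bij[OF g(1) x g(2)] restrict_aut_Bij[OF h(1) x h(2)]
      by (simp add: local_action_def BijGroup_def)
  qed (simp add: local_action_def)
  then have "group_hom ((Aut G arev)\<lparr>carrier := ?S\<rparr>) (local_action G arev H x) ?\<rho>"
    using group by (intro group_hom.intro group_hom_axioms.intro NS.is_group)
  moreover have "?\<rho> ` carrier ((Aut G arev)\<lparr>carrier := ?S\<rparr>) = carrier (local_action G arev H x)"
    by (simp add: local_action_def)
  ultimately have "?\<rho> ` (N \<inter> ?S) \<lhd> local_action G arev H x"
    by (rule NS.surj_hom_normal_subgroup)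
  moreover have "N \<inter> ?S = vertex_stabilizer G arev N x" using NH by (auto simp: vertex_stabilizer_eq)
  ultimately show ?thesis by (simp add: local_action_def)
qed

text \<open>
  The definitions of semiprimitivity and quasiprimitivity speak of the left-hand side.
\<close>

lemma local_action_carrier_update:
  "(local_action G arev H x)\<lparr>carrier := carrier (local_action G arev N x)\<rparr> = local_action G arev N x"
  by (simp add: local_action_def)

lemma perm_transitive_group: "perm_transitive S P \<Longrightarrow> group P"
  unfolding perm_transitive_def
  by (metis group_action.group_hom group_hom.axioms(1) transitive_action.axioms(1))

lemma QZ_local_action_normal:
  assumes "x \<in> verts G" "perm_transitive (out_arcs G x) (local_action G arev H x)"
  shows "carrier (local_action G arev (QZ G arev H) x) \<lhd> local_action G arev H x"
  by (rule local_action_normal[OF QZ_normal assms(1) perm_transitive_group[OF assms(2)]])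

text \<open>
  By conjugation, the quasi-center is locally transitive at the whole \<open>H\<close>-orbit of \<open>x\<close>. Let \<open>y\<close> be a
  neighbour of \<open>x\<close>. Local transitivity of \<open>H\<close> at \<open>y\<close> puts all neighbours of \<open>y\<close> into that orbit, so at each
  of them the quasi-center rotates any arc onto the arc pointing to \<open>y\<close>. Hence the star of \<open>y\<close> is
  a set as required by \<open>discrete_if_QZ_cobounded\<close>. Nothing is claimed about the local action at \<open>y\<close>,
  where the quasi-center may well act trivially.
\<close>

lemma discrete_if_QZ_transitive_at:
  assumes H: "locally_sat G arev H perm_transitive" and x: "x \<in> verts G"
    and Q: "perm_transitive (out_arcs G x) (local_action G arev (QZ G arev H) x)"
  shows "subtopology (perm_topology G arev) H = discrete_topology H"
proof -
  obtain e where e: "e \<in> arcs G" "tail G e = x" using exists_out_arc[OF x] .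
  define y where "y = head G e"
  have y: "y \<in> verts G" using e y_def by simp
  show ?thesis
  proof (rule discrete_if_QZ_cobounded)
    let ?B = "insert y (head G ` out_arcs G y)"
    show "finite ?B" "?B \<noteq> {}" "?B \<subseteq> verts G" using finite_out[OF y] y by auto
    fix f assume f: "f \<in> arcs G" "tail G f \<in> ?B"
    show "\<exists>q\<in>QZ G arev H. fst q (head G f) \<in> ?B"
    proof (cases "tail G f = y")
      case True
      then show ?thesis using f one_in_QZ by (intro bexI[of _ "\<one>\<^sub>A"]) (auto simp: aut_one_apply)
    next
      case False
      then obtain a where a: "a \<in> arcs G" "tail G a = y" "head G a = tail G f" using f by auto
      have "arev e \<in> out_arcs G y" "a \<in> out_arcs G y" using e a y_def by auto
      moreover have "perm_transitive (out_arcs G y) (local_action G arev H y)"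
        using H y by (simp add: locally_sat_def)
      ultimately obtain k where k: "k \<in> H" "snd k (arev e) = a"
        using local_action_transitiveD by metis
      \<comment> \<open>The conjugate of \<open>q\<close> by \<open>k\<close> maps \<open>f\<close> to \<open>arev a\<close>, which ends in \<open>y\<close>.\<close>
      have kx: "snd k e = arev a" using k e aut_graph(3)[of k e] by (metis H_aut arev_arev)
      have ki: "inv\<^sub>A k \<in> H" using k by simp
      have fx: "tail G (snd (inv\<^sub>A k) f) = x"
      proof -
        have "tail G f = fst k x" using a(1,3) kx k e aut_graph(1)[of k e] by simp
        then show ?thesis using f k x by (simp add: aut_closed aut_inv_apply)
      qed
      then have "snd (inv\<^sub>A k) f \<in> out_arcs G x" "e \<in> out_arcs G x"
        using aut_in(2)[OF H_aut[OF ki] f(1)] e by simp_all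
      from local_action_transitiveD[OF Q this] obtain q
        where q: "q \<in> QZ G arev H" "snd q (snd (inv\<^sub>A k) f) = e" by blast
      have qH: "q \<in> H" using QZ_subset q by simp
      have "snd (k \<odot> q \<odot> (inv\<^sub>A k)) f = snd k e"
        using k(1) ki qH f(1) q(2) by (simp add: aut_mult_apply aut_in aut_closed)
      then have "fst (k \<odot> q \<odot> (inv\<^sub>A k)) (head G f) = head G (arev a)"
        using kx aut_graph(2)[of "k \<odot> q \<odot> (inv\<^sub>A k)" f] k(1) ki qH f(1) by simp
      then have "fst (k \<odot> q \<odot> (inv\<^sub>A k)) (head G f) \<in> ?B" using a by simp
      then show ?thesis using QZ_conj[OF q(1) k(1)] by blast
    qed
  qed
qed

lemma discrete_if_semiprimitive:
  assumes H: "locally_sat G arev H perm_semiprimitive"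
    and h: "h \<in> QZ G arev H" "h \<noteq> \<one>\<^sub>A" "edge_fixating G h"
  shows "subtopology (perm_topology G arev) H = discrete_topology H"
proof -
  have trans: "locally_sat G arev H perm_transitive"
    using H by (simp add: locally_sat_def perm_semiprimitive_def)
  have hH: "h \<in> H" using h(1) QZ_subset by blast
  obtain x f f' where x: "x \<in> verts G" and f: "f \<in> out_arcs G x" "snd h f = f"
    and f': "f' \<in> out_arcs G x" "snd h f' \<noteq> f'"
    using moved_arc_beside_fixed_arc[OF H_aut[OF hH] h(2)] h(3) unfolding edge_fixating_def by metis
  have hx: "fst h x = x" using f aut_graph(1)[of h f] hH by auto
  let ?P = "local_action G arev (QZ G arev H) x"
  have "perm_transitive (out_arcs G x) ?P \<or> perm_semiregular (out_arcs G x) ?P"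
    using H x QZ_local_action_normal[OF x] trans
    unfolding locally_sat_def perm_semiprimitive_def by (metis local_action_carrier_update)
  moreover have "\<not> perm_semiregular (out_arcs G x) ?P"
  proof
    assume "perm_semiregular (out_arcs G x) ?P"
    then have "stabilizer ?P (\<lambda>g. g) f = {\<one>\<^bsub>BijGroup (out_arcs G x)\<^esub>}"
      using f(1) by (simp add: perm_semiregular_def local_action_def)
    moreover have "restrict (snd h) (out_arcs G x) \<in> stabilizer ?P (\<lambda>g. g) f"
      using local_action_moves(1)[OF h(1) hx f'] f by (simp add: stabilizer_def)
    ultimately show False using local_action_moves(2)[OF h(1) hx f'] by blast
  qed
  ultimately show ?thesis using discrete_if_QZ_transitive_at[OF trans x] by blast
qed

lemma discrete_if_quasiprimitive:
  assumes H: "locally_sat G arev H perm_quasiprimitive"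
    and h: "h \<in> QZ G arev H" "h \<noteq> \<one>\<^sub>A" and y: "y \<in> verts G" "fst h y = y"
  shows "subtopology (perm_topology G arev) H = discrete_topology H"
proof -
  have trans: "locally_sat G arev H perm_transitive"
    using H by (simp add: locally_sat_def perm_quasiprimitive_def)
  have hH: "h \<in> H" using h(1) QZ_subset by blast
  obtain x f where x: "x \<in> verts G" "fst h x = x" and f: "f \<in> out_arcs G x" "snd h f \<noteq> f"
    using moved_arc_at_fixed_vertex[OF H_aut[OF hH] h(2) y] by blast
  let ?P = "local_action G arev (QZ G arev H) x"
  have "carrier ?P \<noteq> {\<one>\<^bsub>BijGroup (out_arcs G x)\<^esub>}"
    using local_action_moves[OF h(1) x(2) f] by blast
  then have "carrier ?P \<noteq> {\<one>\<^bsub>local_action G arev H x\<^esub>}" by (simp add: local_action_def)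
  then have "perm_transitive (out_arcs G x) ?P"
    using H x QZ_local_action_normal[OF x(1)] trans
    unfolding locally_sat_def perm_quasiprimitive_def by (metis local_action_carrier_update)
  then show ?thesis using discrete_if_QZ_transitive_at[OF trans x(1)] by blast
qed

end

section \<open>Shortest walks and displacement\<close>

lemma not_successively_split:
  "\<not> successively P xs \<Longrightarrow> \<exists>as x y bs. xs = as @ x # y # bs \<and> \<not> P x y"
proof (induction xs)
  case (Cons a xs)
  show ?case
  proof (cases "successively P xs")
    case True
    then obtain b bs where "xs = b # bs" "\<not> P a b" using Cons.prems by (cases xs) auto
    then show ?thesis by (intro exI[of _ "[]"]) auto
  next
    case False
    then obtain as x y bs where "xs = as @ x # y # bs" "\<not> P x y" using Cons.IH by blast
    then show ?thesis by (intro exI[of _ "a # as"]) auto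
  qed
qed simp

context leafless_graph
begin

lemma vdist_le: "awalk x p y \<Longrightarrow> vdist G x y \<le> length p"
  unfolding vdist_def by (intro Least_le) blast

lemma exists_shortest_walk:
  assumes "x \<in> verts G" "y \<in> verts G"
  obtains p where "awalk x p y" "length p = vdist G x y"
proof -
  obtain q where "awalk x q y" using exists_walk assms by blast
  then have "\<exists>n p. awalk x p y \<and> length p = n" by blast
  from LeastI_ex[OF this] show thesis using that unfolding vdist_def by blast
qed

lemma shortest_walk_nonbacktracking:
  assumes p: "awalk x p y" "length p = vdist G x y"
  shows "nonbacktracking arev p"
proof (rule ccontr)
  assume "\<not> ?thesis"
  then obtain as e f bs where split: "p = as @ e # f # bs" "f = arev e"
    using not_successively_split unfolding nonbacktracking_def by blast
  then have "awalk x (as @ bs) y" using p(1) by (auto simp: awalk_Cons_iff)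
  then have "vdist G x y \<le> length (as @ bs)" by (rule vdist_le)
  then show False using p(2) split by simp
qed

lemma vdist_aut_le:
  assumes g: "g \<in> tree_auts G arev" and "x \<in> verts G" "y \<in> verts G"
  shows "vdist G (fst g x) (fst g y) \<le> vdist G x y"
proof -
  obtain p where p: "awalk x p y" "length p = vdist G x y" using exists_shortest_walk assms(2,3) .
  show ?thesis using vdist_le[OF awalk_map_aut[OF g p(1)]] p(2) by simp
qed

lemma tlength_le: "x \<in> verts G \<Longrightarrow> tlength G g \<le> vdist G x (fst g x)"
  unfolding tlength_def by (intro Least_le) blast

lemma tlength_attained: "\<exists>x\<in>verts G. vdist G x (fst g x) = tlength G g"
proof -
  have "\<exists>n. \<exists>x\<in>verts G. vdist G x (fst g x) = n"
    using connected unfolding strongly_connected_def by blast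
  from LeastI_ex[OF this] show ?thesis unfolding tlength_def .
qed

lemma vdist_zero_eq:
  assumes "x \<in> verts G" "y \<in> verts G" "vdist G x y = 0"
  shows "x = y"
  using exists_shortest_walk[OF assms(1,2)] assms(3) by (metis awalk_Nil_iff length_0_conv)

lemma finite_vertex_ball:
  assumes x: "x \<in> verts G"
  shows "finite {y. \<exists>p. awalk x p y \<and> length p \<le> n}"
proof (induction n)
  case 0
  have "{y. \<exists>p. awalk x p y \<and> length p \<le> 0} \<subseteq> {x}" by (auto simp: awalk_Nil_iff)
  then show ?case using finite_subset by blast
next
  case (Suc n)
  let ?B = "\<lambda>n. {y. \<exists>p. awalk x p y \<and> length p \<le> n}"
  have "?B (Suc n) \<subseteq> insert x (\<Union>y\<in>?B n. head G ` out_arcs G y)"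
  proof
    fix y assume "y \<in> ?B (Suc n)"
    then obtain p where p: "awalk x p y" "length p \<le> Suc n" by blast
    show "y \<in> insert x (\<Union>y\<in>?B n. head G ` out_arcs G y)"
    proof (cases p rule: rev_cases)
      case Nil
      then show ?thesis using p by (simp add: awalk_Nil_iff)
    next
      case (snoc q e)
      then have "awalk x q (tail G e)" "e \<in> arcs G" "head G e = y" "length q \<le> n"
        using p by (auto simp: awalk_Cons_iff awalk_Nil_iff)
      then show ?thesis by force
    qed
  qed
  moreover have "finite (insert x (\<Union>y\<in>?B n. head G ` out_arcs G y))"
    using Suc finite_out by (auto dest: awalk_last_in_verts)
  ultimately show ?case by (rule finite_subset)
qed

text \<open>
  Circuits are required to have distinct vertices. A closed walk that repeats a vertex contains a
  shorter closed walk as a contiguous part, which still does not backtrack.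
\<close>

lemma no_closed_nonbacktracking_walk:
  assumes acyclic: "\<not> (\<exists>p. cycle p \<and> nonbacktracking arev p)"
  shows "awalk u p u \<Longrightarrow> nonbacktracking arev p \<Longrightarrow> p = []"
proof (induction "length p" arbitrary: u p rule: less_induct)
  case less
  show ?case
  proof (rule ccontr)
    assume "p \<noteq> []"
    then have rep: "\<not> distinct (tl (awalk_verts u p))"
      using less.prems acyclic unfolding cycle_def by blast
    obtain e es where p: "p = e # es" using \<open>p \<noteq> []\<close> by (cases p) auto
    have es: "awalk (head G e) es u" "\<not> distinct (awalk_verts (head G e) es)"
      using less.prems(1) rep p by (auto simp: awalk_Cons_iff)
    obtain q r s w where r: "es = q @ r @ s" "0 < length r" "awalk w r w"
      using awalk_not_distinct_decomp[OF es] by blast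
    have "nonbacktracking arev r"
      using less.prems(2) p r(1)
      by (auto simp: nonbacktracking_def successively_Cons successively_append_iff)
    then have "r = []" using less.hyps[of r w] r p by simp
    then show False using r(2) by simp
  qed
qed

text \<open>
  For a vertex \<open>x\<close> of minimal displacement at least 2, the shortest walk \<open>p\<close> from \<open>x\<close> to \<open>h x\<close> does not
  fold back onto its image: otherwise the first arc of \<open>p\<close> would end in a vertex of smaller displacement.
  Thus \<open>p\<close>, \<open>h p\<close>, \<open>h\<^sup>2 p\<close>, ... concatenate to a line, and the orbit of \<open>x\<close> consists of infinitely many
  vertices of minimal displacement. In particular an inversion has displacement 1.
\<close>

lemma infinite_min_verts:
  assumes acyclic: "\<not> (\<exists>p. cycle p \<and> nonbacktracking arev p)"
    and h: "h \<in> tree_auts G arev" and long: "2 \<le> tlength G h"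
  shows "infinite (min_verts G h)"
proof -
  obtain x where x: "x \<in> verts G" "vdist G x (fst h x) = tlength G h" using tlength_attained by blast
  obtain p where p: "awalk x p (fst h x)" "length p = tlength G h"
    using exists_shortest_walk[OF x(1) aut_in(1)[OF h x(1)]] x(2) by metis
  have nb_p: "nonbacktracking arev p" using shortest_walk_nonbacktracking p x(2) by simp
  have pne: "p \<noteq> []" using p long by auto
  have turn: "snd h (hd p) \<noteq> arev (last p)"
  proof
    assume folded: "snd h (hd p) = arev (last p)"
    obtain e q f where pe: "p = e # q @ [f]"
      using p(2) long by (cases p; cases "tl p" rule: rev_cases) auto
    have e: "e \<in> arcs G" "f \<in> arcs G" "awalk (head G e) q (tail G f)"
      using p(1) pe by (auto simp: awalk_Cons_iff)
    have "fst h (head G e) = head G (snd h e)" using h e by simp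
    also have "\<dots> = tail G f" using folded pe e by simp
    finally have "vdist G (head G e) (fst h (head G e)) \<le> length q" using vdist_le e(3) by simp
    then have "tlength G h \<le> length q" using tlength_le[of "head G e" h] e(1) by simp
    then show False using p(2) pe by simp
  qed
  \<comment> \<open>\<open>W n\<close> is the walk \<open>p\<close>, \<open>h p\<close>, ..., \<open>h\<^sup>n\<^sup>-\<^sup>1 p\<close> from \<open>x\<close> to \<open>h\<^sup>n x\<close>.\<close>
  define W where "W = rec_nat [] (\<lambda>_ w. p @ map (snd h) w)"
  have W: "W 0 = []" "\<And>n. W (Suc n) = p @ map (snd h) (W n)" by (simp_all add: W_def)
  let ?y = "\<lambda>n. (fst h ^^ n) x"
  have y: "?y n \<in> verts G" for n by (induction n) (use x aut_in(1)[OF h] in auto)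
  have walk: "awalk x (W n) (?y n)" for n
  proof (induction n)
    case (Suc n)
    then show ?case using awalk_map_aut[OF h Suc] p(1) by (auto simp: W)
  qed (simp add: W awalk_Nil_iff x)
  have hdW: "hd (W n) = hd p" if "n \<noteq> 0" for n using that pne by (cases n) (simp_all add: W)
  have nbW: "nonbacktracking arev (W n)" for n
  proof (induction n)
    case (Suc n)
    have "set (W n) \<subseteq> arcs G" using walk by blast
    then have "nonbacktracking arev (map (snd h) (W n))"
      using Suc unfolding nonbacktracking_def successively_map
    proof (elim successively_mono)
      fix e f assume ef: "e \<in> set (W n)" "f \<in> set (W n)" "f \<noteq> arev e" and "set (W n) \<subseteq> arcs G"
      then have "e \<in> arcs G" "f \<in> arcs G" by auto
      then show "snd h f \<noteq> arev (snd h e)"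
        using ef(3) h aut_inv_apply(3)[OF h] by (metis arev_in_arcs aut_graph(3))
    qed
    moreover have "hd (map (snd h) (W n)) \<noteq> arev (last p)" if "map (snd h) (W n) \<noteq> []"
      using that turn hdW[of n] W(1) by (cases n) (simp_all add: hd_map)
    ultimately show ?case
      using nb_p by (auto simp: W nonbacktracking_def successively_append_iff)
  qed (simp add: W nonbacktracking_def)
  have aperiodic: "n = 0" if "?y n = x" for n
  proof -
    have "W n = []" using no_closed_nonbacktracking_walk[OF acyclic] walk[of n] nbW that by metis
    then show ?thesis using pne by (cases n) (auto simp: W)
  qed
  have injh: "inj_on (fst h) (verts G)" using aut_Bij(1)[OF h] by (simp add: Bij_def bij_betw_def)
  have "inj ?y"
  proof (rule linorder_injI)
    fix m n :: nat assume "m < n"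
    moreover have "?y m \<noteq> ?y (m + k)" if "k \<noteq> 0" for m k
      by (induction m) (use that aperiodic[of k] y injh in \<open>auto dest: inj_onD\<close>)
    from this[of "n - m" m] show "?y m \<noteq> ?y n" using \<open>m < n\<close> by simp
  qed
  then have "infinite (range ?y)" by (rule range_inj_infinite)
  moreover have "?y n \<in> min_verts G h" for n
  proof (induction n)
    case 0
    then show ?case using x by (simp add: min_verts_def)
  next
    case (Suc n)
    have "vdist G (fst h (?y n)) (fst h (fst h (?y n))) \<le> tlength G h"
      using vdist_aut_le[OF h y aut_in(1)[OF h y], of n n] Suc by (simp add: min_verts_def)
    then show ?case using tlength_le[OF y, of h "Suc n"] y[of "Suc n"] by (simp add: min_verts_def)
  qed
  ultimately show ?thesis by (meson finite_subset image_subset_iff)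
qed

end

section \<open>Local transitivity on paths\<close>

context leafless_graph_action
begin

text \<open>
  Conjugating \<open>h\<close> by the stabilizer of \<open>x\<close> shows that every endpoint of a non-backtracking path of
  length \<open>k\<close> from \<open>x\<close> lies in the orbit of \<open>x\<close> under the quasi-center. Take for \<open>B\<close> the ball of radius \<open>k\<close>:
  a vertex \<open>w\<close> at distance \<open>k + 1\<close> is adjacent to such an endpoint \<open>z\<close>, and moving \<open>z\<close> back to \<open>x\<close> puts \<open>w\<close>
  at distance 1 from \<open>x\<close>.
\<close>

lemma discrete_if_path_transitive:
  assumes x: "x \<in> verts G" and k: "1 \<le> k"
    and h: "h \<in> QZ G arev H" "vdist G x (fst h x) = k"
    and trans: "\<And>p q. p \<in> nb_paths G arev k x \<Longrightarrow> q \<in> nb_paths G arev k x \<Longrightarrow>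
      \<exists>g\<in>H. fst g x = x \<and> map (snd g) p = q"
  shows "subtopology (perm_topology G arev) H = discrete_topology H"
proof (rule discrete_if_QZ_cobounded)
  let ?B = "{y. \<exists>p. awalk x p y \<and> length p \<le> k}"
  show "finite ?B" using finite_vertex_ball[OF x] .
  have "x \<in> ?B" using x by (intro CollectI exI[of _ "[]"]) (simp add: awalk_Nil_iff)
  then show "?B \<noteq> {}" by blast
  show "?B \<subseteq> verts G" by (auto dest: awalk_last_in_verts)
  have hH: "h \<in> H" using h(1) QZ_subset by blast
  obtain p where p: "awalk x p (fst h x)" "length p = k"
    using exists_shortest_walk[OF x aut_in(1)[OF H_aut[OF hH] x]] h(2) by metis
  have p_nb: "p \<in> nb_paths G arev k x"
    using p shortest_walk_nonbacktracking h(2) by (auto simp: nb_paths_def)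
  fix f assume f: "f \<in> arcs G" "tail G f \<in> ?B"
  then obtain s where s: "awalk x s (tail G f)" "length s \<le> k" by blast
  let ?w = "head G f"
  have w: "?w \<in> verts G" using f by simp
  show "\<exists>q\<in>QZ G arev H. fst q ?w \<in> ?B"
  proof (cases "vdist G x ?w \<le> k")
    case True
    then have "?w \<in> ?B" using exists_shortest_walk[OF x w] by (metis (mono_tags, lifting) mem_Collect_eq)
    then show ?thesis using one_in_QZ w by (intro bexI[of _ "\<one>\<^sub>A"]) (simp_all add: aut_one_apply)
  next
    case False
    have "awalk x (s @ [f]) ?w" using s(1) f(1) by (auto simp: awalk_Cons_iff awalk_Nil_iff)
    from vdist_le[OF this] have dist: "vdist G x ?w = Suc k" using s(2) False by simp
    obtain r where r: "awalk x r ?w" "length r = Suc k" using exists_shortest_walk[OF x w] dist by metis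
    then obtain r' a where ra: "r = r' @ [a]" by (metis length_Suc_conv_rev)
    define z where "z = tail G a"
    have a: "a \<in> arcs G" "tail G a = z" "head G a = ?w" and r': "awalk x r' z"
      using r(1) ra z_def by (auto simp: awalk_Cons_iff awalk_Nil_iff)
    have "nonbacktracking arev r" using shortest_walk_nonbacktracking r dist by simp
    then have "r' \<in> nb_paths G arev k x"
      using r' r(2) ra by (auto simp: nb_paths_def nonbacktracking_def successively_append_iff)
    from trans[OF p_nb this] obtain g where g: "g \<in> H" "fst g x = x" "map (snd g) p = r'" by blast
    have gp: "awalk x r' (fst g (fst h x))" using awalk_map_aut[OF H_aut[OF g(1)] p(1)] g by simp
    have gh: "fst g (fst h x) = z" using awalk_ends[OF gp r'] p(2) k g(3) by auto
    let ?q = "g \<odot> (inv\<^sub>A h) \<odot> (inv\<^sub>A g)"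
    have hq: "inv\<^sub>A h \<in> QZ G arev H" using subgroup.m_inv_closed[OF QZ_subgroup h(1)] .
    have q: "?q \<in> QZ G arev H" using QZ_conj[OF hq g(1)] .
    have qH: "?q \<in> H" using QZ_subset q by blast
    have qz: "fst ?q z = x"
      unfolding gh[symmetric] using g hH x by (simp add: aut_mult_apply aut_inv_apply aut_in aut_closed)
    have "awalk z [a] ?w" using a w by (simp add: awalk_Cons_iff awalk_Nil_iff)
    from awalk_map_aut[OF H_aut[OF qH] this]
    have "awalk x [snd ?q a] (fst ?q ?w)" unfolding qz by (simp only: list.map)
    then have "fst ?q ?w \<in> ?B" using k by (intro CollectI exI[of _ "[snd ?q a]"]) simp
    then show ?thesis using q by blast
  qed
qed

lemma k_transitive_local_actionD:
  assumes "perm_k_transitive k (out_arcs G x) (local_action G arev H x)"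
    and "set es \<subseteq> out_arcs G x" "set fs \<subseteq> out_arcs G x" "distinct es" "distinct fs"
    and "length es = k" "length fs = k"
  shows "\<exists>g\<in>H. fst g x = x \<and> map (snd g) es = fs"
proof -
  obtain p where p: "p \<in> (\<lambda>h. restrict (snd h) (out_arcs G x)) ` vertex_stabilizer G arev H x"
      "map p es = fs"
    using assms unfolding perm_k_transitive_def carrier_local_action by blast
  from p(1) obtain g where g: "g \<in> vertex_stabilizer G arev H x" "p = restrict (snd g) (out_arcs G x)"
    by (rule imageE)
  have "map (snd g) es = fs"
    unfolding p(2)[symmetric] g(2) using assms(2) by (auto simp: in_mono)
  then show ?thesis using g(1) by (intro bexI[of _ g]) (simp_all add: vertex_stabilizer_eq)
qed

lemma nb_paths_1:
  "p \<in> nb_paths G arev 1 x \<Longrightarrow> \<exists>e\<in>out_arcs G x. p = [e]"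
  by (auto simp: nb_paths_def length_Suc_conv awalk_Cons_iff)

lemma nb_paths_2:
  "p \<in> nb_paths G arev 2 x \<Longrightarrow>
    \<exists>e f. p = [e, f] \<and> e \<in> out_arcs G x \<and> f \<in> out_arcs G (head G e) \<and> f \<noteq> arev e"
  by (auto simp: nb_paths_def length_Suc_conv awalk_Cons_iff nonbacktracking_def numeral_2_eq_2)

lemma other_out_arc:
  assumes "x \<in> verts G"
  obtains f where "f \<in> out_arcs G x" "f \<noteq> e"
proof -
  have "\<not> out_arcs G x \<subseteq> {e}"
    using degree_ge_2[OF assms] card_mono[of "{e}" "out_arcs G x"] by auto
  then show thesis using that by blast
qed

lemma locally_1_transitive_paths:
  assumes H: "\<And>e f. e \<in> out_arcs G x \<Longrightarrow> f \<in> out_arcs G x \<Longrightarrow> \<exists>g\<in>H. fst g x = x \<and> snd g e = f"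
    and p: "p \<in> nb_paths G arev 1 x" and q: "q \<in> nb_paths G arev 1 x"
  shows "\<exists>g\<in>H. fst g x = x \<and> map (snd g) p = q"
proof -
  obtain e f where "e \<in> out_arcs G x" "f \<in> out_arcs G x" "p = [e]" "q = [f]"
    using nb_paths_1 p q by blast
  then show ?thesis using H[of e f] by simp
qed

text \<open>
  2-transitivity at \<open>x\<close> aligns the first arcs. The second arcs are then aligned by an element at the
  next vertex that keeps the arc pointing back to \<open>x\<close>, and hence \<open>x\<close>, in place.
\<close>

lemma locally_2_transitive_paths:
  assumes H: "locally_sat G arev H (perm_k_transitive 2)" and x: "x \<in> verts G"
    and p: "p \<in> nb_paths G arev 2 x" and q: "q \<in> nb_paths G arev 2 x"
  shows "\<exists>g\<in>H. fst g x = x \<and> map (snd g) p = q"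
proof -
  obtain e1 e2 where p': "p = [e1, e2]" and e: "e1 \<in> out_arcs G x" "e2 \<in> out_arcs G (head G e1)" "e2 \<noteq> arev e1"
    using nb_paths_2[OF p] by blast
  obtain f1 f2 where q': "q = [f1, f2]" and f: "f1 \<in> out_arcs G x" "f2 \<in> out_arcs G (head G f1)" "f2 \<noteq> arev f1"
    using nb_paths_2[OF q] by blast
  \<comment> \<open>Local 2-transitivity acts on pairs of distinct arcs, so \<open>e1\<close> and \<open>f1\<close> need partners.\<close>
  obtain a where a: "a \<in> out_arcs G x" "a \<noteq> e1" using other_out_arc[OF x] .
  obtain b where b: "b \<in> out_arcs G x" "b \<noteq> f1" using other_out_arc[OF x] .
  have two: "perm_k_transitive 2 (out_arcs G y) (local_action G arev H y)" if "y \<in> verts G" for y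
    using H that by (simp add: locally_sat_def)
  obtain g where g: "g \<in> H" "fst g x = x" "snd g e1 = f1"
    using k_transitive_local_actionD[OF two[OF x], of "[e1, a]" "[f1, b]"] e(1) f(1) a b by auto
  let ?y = "head G f1"
  have y: "?y \<in> verts G" using f by simp
  have gy: "fst g (head G e1) = ?y" using g e(1) aut_graph(2)[of g e1] by simp
  have ge2: "snd g e2 \<in> out_arcs G ?y" using g(1) e gy aut_in(2)[OF H_aut[OF g(1)], of e2] by simp
  have "snd g e2 \<noteq> arev f1"
  proof
    assume "snd g e2 = arev f1"
    also have "\<dots> = snd g (arev e1)" using g e(1) by simp
    finally have "e2 = arev e1"
      using aut_inv_apply(3)[OF H_aut[OF g(1)]] e by (metis arev_in_arcs in_out_arcs_conv)
    then show False using e(3) by simp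
  qed
  then obtain k where k: "k \<in> H" "fst k ?y = ?y" "snd k (arev f1) = arev f1" "snd k (snd g e2) = f2"
    using k_transitive_local_actionD[OF two[OF y], of "[arev f1, snd g e2]" "[arev f1, f2]"] ge2 f by auto
  have kf: "snd k f1 = f1" using k(1,3) f(1) aut_graph(3)[of k f1] by (simp add: arev_eq_iff)
  then have "fst k x = x" using k(1) f(1) aut_graph(1)[of k f1] by simp
  then have "fst (k \<odot> g) x = x" "map (snd (k \<odot> g)) p = q"
    using g k kf e f p' q' x by (simp_all add: aut_mult_apply)
  then show ?thesis using g(1) k(1) by (intro bexI[of _ "k \<odot> g"]) simp_all
qed

lemma locally_k_transitive_paths:
  assumes H: "locally_k_transitive G arev H k" and k: "1 \<le> k" and x: "x \<in> verts G"
    and p: "p \<in> nb_paths G arev k x" and q: "q \<in> nb_paths G arev k x"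
  shows "\<exists>g\<in>H. fst g x = x \<and> map (snd g) p = q"
proof -
  consider "k = 1" | "k = 2" | "k \<ge> 3" using k by linarith
  then show ?thesis
  proof cases
    case 1
    have "\<exists>g\<in>H. fst g x = x \<and> snd g e = f" if "e \<in> out_arcs G x" "f \<in> out_arcs G x" for e f
      using k_transitive_local_actionD[of 1 x "[e]" "[f]"] H x that 1
      by (simp add: locally_k_transitive_def locally_sat_def)
    then show ?thesis using locally_1_transitive_paths p q 1 by metis
  next
    case 2
    then show ?thesis
      using locally_2_transitive_paths[OF _ x] H p q by (simp add: locally_k_transitive_def)
  next
    case 3
    then have "\<exists>h\<in>vertex_stabilizer G arev H x. map (snd h) p = q"
      using H x p q unfolding locally_k_transitive_def by simp
    then obtain h where "h \<in> vertex_stabilizer G arev H x" "map (snd h) p = q" by (rule bexE)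
    then show ?thesis by (intro bexI[of _ h]) (simp_all add: vertex_stabilizer_eq)
  qed
qed

end

section \<open>Quasi-centers of non-discrete groups\<close>

theorem theorem4p1:
  fixes T :: "('v, 'e) pre_digraph" and arev :: "'e \<Rightarrow> 'e" and d :: nat
    and H :: "(('v \<Rightarrow> 'v) \<times> ('e \<Rightarrow> 'e)) set"
  assumes "d \<ge> 3"
    and "regular_tree d T arev"
    and "subgroup H (Aut T arev)"
    and "subtopology (perm_topology T arev) H \<noteq> discrete_topology H"
  shows
    "(locally_sat T arev H perm_transitive \<longrightarrow>
        \<not> (\<exists>h\<in>QZ T arev H. tree_inversion T h)) \<and>
     (locally_sat T arev H perm_semiprimitive \<longrightarrow>
        \<not> (\<exists>h\<in>QZ T arev H. h \<noteq> \<one>\<^bsub>Aut T arev\<^esub> \<and> edge_fixating T h)) \<and>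
     (locally_sat T arev H perm_quasiprimitive \<longrightarrow>
        \<not> (\<exists>h\<in>QZ T arev H. h \<noteq> \<one>\<^bsub>Aut T arev\<^esub> \<and> elliptic T h)) \<and>
     (\<forall>k::nat. locally_k_transitive T arev H k \<longrightarrow>
        \<not> (\<exists>h\<in>QZ T arev H. hyperbolic T h \<and> tlength T h = k))"
proof -
  have tree: "serre_tree T arev" using assms(2) by (simp add: regular_tree_def)
  then have acyclic: "\<not> (\<exists>p. pre_digraph.cycle T p \<and> nonbacktracking arev p)"
    by (simp add: serre_tree_def)
  have graph: "bidirected_digraph T arev" "strongly_connected T"
    using tree by (simp_all add: serre_tree_def)
  have degree: "2 \<le> card (out_arcs T x)" if "x \<in> verts T" for x
    using that assms(1,2) by (simp add: regular_tree_def)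
  interpret leafless_graph_action T arev H
    by (intro leafless_graph_action.intro leafless_graph_action_axioms.intro
        leafless_graph.intro leafless_graph_axioms.intro graph degree assms(3))
  show ?thesis
  proof (intro conjI impI allI notI; elim bexE conjE)
    fix h assume trans: "locally_sat T arev H perm_transitive"
      and h: "h \<in> QZ T arev H" "tree_inversion T h"
    have hH: "h \<in> H" using h(1) QZ_subset by blast
    \<comment> \<open>An inversion has minimal displacement 1, so the argument for hyperbolic elements applies with \<open>k = 1\<close>.\<close>
    have one: "tlength T h = 1"
      using infinite_min_verts[OF acyclic H_aut[OF hH]] h(2) unfolding tree_inversion_def by linarith
    obtain x where x: "x \<in> verts T" "vdist T x (fst h x) = 1" using tlength_attained one by metis
    have "\<exists>g\<in>H. fst g x = x \<and> snd g e = f" if "e \<in> out_arcs T x" "f \<in> out_arcs T x" for e f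
      using local_action_transitiveD trans x(1) that unfolding locally_sat_def by blast
    then show False
      using discrete_if_path_transitive[OF x(1) _ h(1) x(2)] locally_1_transitive_paths assms(4) by simp
  next
    fix h assume "locally_sat T arev H perm_semiprimitive" "h \<in> QZ T arev H"
      "h \<noteq> \<one>\<^bsub>Aut T arev\<^esub>" "edge_fixating T h"
    then show False using discrete_if_semiprimitive assms(4) by simp
  next
    fix h assume H: "locally_sat T arev H perm_quasiprimitive"
      and h: "h \<in> QZ T arev H" "h \<noteq> \<one>\<^bsub>Aut T arev\<^esub>" "elliptic T h"
    have hH: "h \<in> H" using h(1) QZ_subset by blast
    obtain y where y: "y \<in> verts T" "vdist T y (fst h y) = 0"
      using tlength_attained h(3) unfolding elliptic_def by metis
    then have "fst h y = y" using vdist_zero_eq aut_in(1)[OF H_aut[OF hH]] by metis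
    then show False using discrete_if_quasiprimitive[OF H h(1,2) y(1)] assms(4) by simp
  next
    fix k h assume H: "locally_k_transitive T arev H k"
      and h: "h \<in> QZ T arev H" "hyperbolic T h" "tlength T h = k"
    have k: "1 \<le> k" using h unfolding hyperbolic_def by simp
    obtain x where x: "x \<in> verts T" "vdist T x (fst h x) = k" using tlength_attained h(3) by metis
    show False
      using discrete_if_path_transitive[OF x(1) k h(1) x(2)] locally_k_transitive_paths[OF H k x(1)] assms(4)
      by simp
  qed
qed

end
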